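(* For parameters $\alpha,\beta$ and variables $x_1,\dots,x_m$, $y_1,\dots,y_n$, $$\sum_{\lambda}G^{(-\beta,-\alpha)}_{\lambda'}(x_1,\dots,x_m)\,g^{(\alpha,\beta)}_\lambda(y_1,\dots,y_n)=\prod_{1\le i\le m,\,1\le j\le n}(1+x_iy_j),$$ the sum running over all partitions $\lambda$, with $\lambda'$ the conjugate partition.
   Context: Canonical Grothendieck polynomials: for $\mu\subseteq\lambda$, $\lambda/\mu$ is a horizontal strip if $\lambda_1\ge\mu_1\ge\lambda_2\ge\cdots$; $\bar\lambda=(\lambda_2,\lambda_3,\dots)$; $r(\kappa/\nu)$ is the number of $i$ with $\kappa_i>\nu_i$. $G^{(\alpha,\beta)}_\lambda()=\delta_{\lambda,\emptyset}$ (no variables) and $G^{(\alpha,\beta)}_\lambda(x_1,\dots,x_{n+1})=\sum_{\mu:\lambda/\mu\text{ horizontal strip}}G^{(\alpha,\beta)}_\mu(x_1,\dots,x_n)\big(\frac{x}{1-\alpha x}\big)^{|\lambda|-|\mu|}\big(\frac{1+\beta x}{1-\alpha x}\big)^{r(\mu/\bar\lambda)}$, $x=x_{n+1}$; $G^{(-\beta,-\alpha)}$ is obtained by substituting $(\alpha,\beta)\mapsto(-\beta,-\alpha)$. Dual canonical Grothendieck polynomials: for $\mu\subseteq\lambda$ let $r,c,b$ be the numbers of nonempty rows, nonempty columns and edge-connected components of $\lambda/\mu$; $g^{(\alpha,\beta)}_\lambda()=\delta_{\lambda,\emptyset}$ and $g^{(\alpha,\beta)}_\lambda(x_1,\dots,x_{n+1})=\sum_{\mu\subseteq\lambda}g^{(\alpha,\beta)}_\mu(x_1,\dots,x_n)\beta^{r-b}(\alpha+\beta)^{|\lambda|-|\mu|-r-c+b}x_{n+1}^{b}(\alpha+x_{n+1})^{c-b}$.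 *)

theory Defs
  imports "HOL-Analysis.Infinite_Sum" "HOL-Library.Multiset"
begin

section \<open>Formal power series in several variables\<close>

text \<open>
  A monomial in variables indexed by \<open>'v\<close> is represented by the multiset of its
  variables; a series is the family of its coefficients.
\<close>

typedef ('v, 'a) mfps = "UNIV :: ('v multiset \<Rightarrow> 'a) set"
  morphisms mcoeff Abs_mfps ..

setup_lifting type_definition_mfps

lemma mfps_eqI: "(\<And>M. mcoeff f M = mcoeff g M) \<Longrightarrow> f = g"
  by (simp add: mcoeff_inject[symmetric] fun_eq_iff)

lemma finite_submultisets: "finite {N. N \<subseteq># M}"
proof (induction M)
  case empty
  then show ?case by simp
next
  case (add x M)
  have "{N. N \<subseteq># add_mset x M} \<subseteq> {N. N \<subseteq># M} \<union> add_mset x ` {N. N \<subseteq># M}"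
  proof
    fix N assume "N \<in> {N. N \<subseteq># add_mset x M}"
    then have N: "N \<subseteq># add_mset x M" by simp
    show "N \<in> {N. N \<subseteq># M} \<union> add_mset x ` {N. N \<subseteq># M}"
    proof (cases "x \<in># N")
      case True
      then obtain K where "N = add_mset x K" by (metis multi_member_split)
      with N show ?thesis by auto
    next
      case False
      with N have "N \<subseteq># M"
        by (metis diff_single_trivial diff_single_eq_union subset_eq_diff_conv
            add_mset_add_single)
      then show ?thesis by simp
    qed
  qed
  with add.IH show ?case by (meson finite_UnI finite_imageI finite_subset)
qed

instantiation mfps :: (type, comm_ring_1) comm_ring_1
begin

lift_definition zero_mfps :: "('a, 'b) mfps" is "\<lambda>_. 0" .
lift_definition one_mfps :: "('a, 'b) mfps" is "\<lambda>M. if M = {#} then 1 else 0" .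
lift_definition plus_mfps :: "('a, 'b) mfps \<Rightarrow> ('a, 'b) mfps \<Rightarrow> ('a, 'b) mfps"
  is "\<lambda>f g M. f M + g M" .
lift_definition minus_mfps :: "('a, 'b) mfps \<Rightarrow> ('a, 'b) mfps \<Rightarrow> ('a, 'b) mfps"
  is "\<lambda>f g M. f M - g M" .
lift_definition uminus_mfps :: "('a, 'b) mfps \<Rightarrow> ('a, 'b) mfps"
  is "\<lambda>f M. - f M" .
lift_definition times_mfps :: "('a, 'b) mfps \<Rightarrow> ('a, 'b) mfps \<Rightarrow> ('a, 'b) mfps"
  is "\<lambda>f g M. \<Sum>N | N \<subseteq># M. f N * g (M - N)" .

instance
proof
  fix f g h :: "('a, 'b) mfps"
  show "f + g + h = f + (g + h)" by transfer (simp add: add.assoc)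
  show "f + g = g + f" by transfer (simp add: add.commute)
  show "0 + f = f" by transfer simp
  show "- f + f = 0" by transfer simp
  show "f - g = f + - g" by transfer simp
  show "(0 :: ('a, 'b) mfps) \<noteq> 1" by transfer (auto simp: fun_eq_iff)
  show "(f + g) * h = f * h + g * h"
    by transfer (simp add: distrib_right sum.distrib)
  show "f * g = g * f"
  proof (transfer, rule ext)
    fix f g :: "'a multiset \<Rightarrow> 'b" and M
    show "(\<Sum>N | N \<subseteq># M. f N * g (M - N)) = (\<Sum>N | N \<subseteq># M. g N * f (M - N))"
      by (rule sum.reindex_bij_witness[where i = "\<lambda>N. M - N" and j = "\<lambda>N. M - N"])
        (auto simp: mult.commute subset_mset.diff_diff_right)
  qed
  show "1 * f = f"
  proof (transfer, rule ext)
    fix f :: "'a multiset \<Rightarrow> 'b" and M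
    have "(\<Sum>N | N \<subseteq># M. (if N = {#} then 1 else 0) * f (M - N))
        = (\<Sum>N\<in>{{#}}. (if N = {#} then 1 else 0) * f (M - N))"
      by (rule sum.mono_neutral_right) (auto simp: finite_submultisets)
    then show "(\<Sum>N | N \<subseteq># M. (if N = {#} then 1 else 0) * f (M - N)) = f M"
      by simp
  qed
  show "f * g * h = f * (g * h)"
  proof (transfer, rule ext)
    fix f g h :: "'a multiset \<Rightarrow> 'b" and M
    have "(\<Sum>N | N \<subseteq># M. (\<Sum>K | K \<subseteq># N. f K * g (N - K)) * h (M - N))
        = (\<Sum>(N, K) \<in> (SIGMA N : {N. N \<subseteq># M}. {K. K \<subseteq># N}). f K * g (N - K) * h (M - N))"
      by (simp add: sum.Sigma finite_submultisets sum_distrib_right)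
    also have "\<dots> = (\<Sum>(K, L) \<in> (SIGMA K : {K. K \<subseteq># M}. {L. L \<subseteq># M - K}).
        f K * (g L * h (M - K - L)))"
    proof (rule sum.reindex_bij_witness[where i = "\<lambda>(K, L). (K + L, K)"
            and j = "\<lambda>(N, K). (K, N - K)"])
    qed (auto simp: mset_subset_eq_exists_conv mult.assoc add.assoc)
    also have "\<dots> = (\<Sum>K | K \<subseteq># M. f K * (\<Sum>L | L \<subseteq># M - K. g L * h (M - K - L)))"
      by (simp add: sum.Sigma finite_submultisets sum_distrib_left)
    finally show "(\<Sum>N | N \<subseteq># M. (\<Sum>K | K \<subseteq># N. f K * g (N - K)) * h (M - N))
        = (\<Sum>K | K \<subseteq># M. f K * (\<Sum>L | L \<subseteq># M - K. g L * h (M - K - L)))" .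
  qed
qed

end

lift_definition mConst :: "'a :: comm_ring_1 \<Rightarrow> ('v, 'a) mfps"
  is "\<lambda>c M. if M = {#} then c else 0" .

lift_definition mVar :: "'v \<Rightarrow> ('v, 'a :: comm_ring_1) mfps"
  is "\<lambda>v M. if M = {#v#} then 1 else 0" .

text \<open>The inverse is the ring inverse on units, with the usual value 0 elsewhere.\<close>

instantiation mfps :: (type, comm_ring_1) inverse
begin

definition inverse_mfps_def:
  "inverse (f :: ('a, 'b) mfps) = (if f dvd 1 then THE g. f * g = 1 else 0)"

definition divide_mfps_def:
  "(f :: ('a, 'b) mfps) div g = f * inverse g"

instance ..

end

lemma mfps_right_inverse:
  fixes f :: "('v, 'a :: comm_ring_1) mfps"
  assumes "f dvd 1"
  shows "f * inverse f = 1"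
proof -
  from assms obtain g where g: "f * g = 1" by (metis dvdE)
  have "(THE g. f * g = 1) = g"
  proof (rule the_equality[where P = "\<lambda>g. f * g = 1", OF g])
    fix h assume h: "f * h = 1"
    have "h = h * (f * g)" using g by simp
    also have "\<dots> = (f * h) * g" by (simp add: ac_simps)
    finally show "h = g" using h by simp
  qed
  with g assms show ?thesis by (simp add: inverse_mfps_def)
qed

lemma mfps_geometric_unit:
  fixes a :: "'a :: comm_ring_1" and v :: 'v
  shows "(1 - mConst a * mVar v) dvd (1 :: ('v, 'a) mfps)"
proof -
  define geo :: "('v, 'a) mfps" where
    "geo = Abs_mfps (\<lambda>M. if set_mset M \<subseteq> {v} then a ^ size M else 0)"
  have geo: "mcoeff geo M = (if set_mset M \<subseteq> {v} then a ^ size M else 0)" for M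
    by (simp add: geo_def Abs_mfps_inverse)
  have C: "mcoeff (mConst a * f) M = a * mcoeff f M" for f :: "('v, 'a) mfps" and M
  proof -
    have "mcoeff (mConst a * f) M
        = (\<Sum>N | N \<subseteq># M. (if N = {#} then a else 0) * mcoeff f (M - N))"
      by (simp add: times_mfps.rep_eq mConst.rep_eq)
    also have "\<dots> = (\<Sum>N\<in>{{#}}. (if N = {#} then a else 0) * mcoeff f (M - N))"
      by (rule sum.mono_neutral_right) (auto simp: finite_submultisets)
    finally show ?thesis by simp
  qed
  have V: "mcoeff (mVar v * f) M = (if v \<in># M then mcoeff f (M - {#v#}) else 0)"
    for f :: "('v, 'a) mfps" and M
  proof -
    have "mcoeff (mVar v * f) M
        = (\<Sum>N | N \<subseteq># M. (if N = {#v#} then 1 else 0) * mcoeff f (M - N))"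
      by (simp add: times_mfps.rep_eq mVar.rep_eq)
    also have "\<dots> = (\<Sum>N\<in>(if v \<in># M then {{#v#}} else {}).
        (if N = {#v#} then 1 else 0) * mcoeff f (M - N))"
      by (rule sum.mono_neutral_right) (auto simp: finite_submultisets)
    finally show ?thesis by simp
  qed
  have "(1 - mConst a * mVar v) * geo = 1"
  proof (rule mfps_eqI)
    fix M
    have "mcoeff ((1 - mConst a * mVar v) * geo) M
        = mcoeff geo M - (if v \<in># M then a * mcoeff geo (M - {#v#}) else 0)"
      by (simp add: left_diff_distrib minus_mfps.rep_eq mult.assoc C V)
    also have "\<dots> = (if M = {#} then 1 else 0)"
    proof (cases "v \<in># M")
      case True
      then obtain K where "M = add_mset v K" by (metis multi_member_split)
      then show ?thesis by (simp add: geo)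
    next
      case False
      then show ?thesis by (auto simp: geo subset_singleton_iff)
    qed
    finally show "mcoeff ((1 - mConst a * mVar v) * geo) M = mcoeff 1 M"
      by (simp add: one_mfps.rep_eq)
  qed
  then show ?thesis by (metis dvdI)
qed

text \<open>
  Topology of coefficientwise convergence, the coefficients being discrete: a family of
  series is summable iff each monomial has a nonzero coefficient in only finitely many
  of its members.
\<close>

instantiation mfps :: (type, comm_ring_1) t2_space
begin

definition open_mfps :: "('a, 'b) mfps set \<Rightarrow> bool" where
  "open U \<longleftrightarrow> (\<forall>f\<in>U. \<exists>S. finite S \<and>
     (\<forall>g. (\<forall>M\<in>S. mcoeff g M = mcoeff f M) \<longrightarrow> g \<in> U))"

instance
proof
  show "open (UNIV :: ('a, 'b) mfps set)" by (auto simp: open_mfps_def)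
next
  fix U V :: "('a, 'b) mfps set"
  assume U: "open U" and V: "open V"
  show "open (U \<inter> V)"
    unfolding open_mfps_def
  proof
    fix f assume f: "f \<in> U \<inter> V"
    from U f obtain S where S: "finite S"
      "\<And>g. (\<forall>M\<in>S. mcoeff g M = mcoeff f M) \<Longrightarrow> g \<in> U"
      unfolding open_mfps_def by blast
    from V f obtain T where T: "finite T"
      "\<And>g. (\<forall>M\<in>T. mcoeff g M = mcoeff f M) \<Longrightarrow> g \<in> V"
      unfolding open_mfps_def by blast
    from S T show "\<exists>S. finite S \<and>
        (\<forall>g. (\<forall>M\<in>S. mcoeff g M = mcoeff f M) \<longrightarrow> g \<in> U \<inter> V)"
      by (intro exI[of _ "S \<union> T"]) auto
  qed
next
  fix K :: "('a, 'b) mfps set set"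
  assume "\<forall>U\<in>K. open U"
  then show "open (\<Union>K)" unfolding open_mfps_def by (meson UnionE UnionI)
next
  fix f g :: "('a, 'b) mfps"
  assume "f \<noteq> g"
  then obtain M where "mcoeff f M \<noteq> mcoeff g M" using mfps_eqI by blast
  moreover have "open {h :: ('a, 'b) mfps. mcoeff h M = c}" for c
    unfolding open_mfps_def by (auto intro!: exI[of _ "{M}"])
  ultimately show "\<exists>U V. open U \<and> open V \<and> f \<in> U \<and> g \<in> V \<and> U \<inter> V = {}"
    by (intro exI[of _ "{h. mcoeff h M = mcoeff f M}"]
        exI[of _ "{h. mcoeff h M = mcoeff g M}"]) auto
qed

end

section \<open>Partitions and skew shapes\<close>

text \<open>
  Parts are indexed from 0: \<open>lam i\<close> is the part usually written $\lambda_{i+1}$.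
  Containment of diagrams is the pointwise order on functions.
\<close>

definition is_partition :: "(nat \<Rightarrow> nat) \<Rightarrow> bool" where
  "is_partition lam \<longleftrightarrow> antimono lam \<and> finite {i. lam i \<noteq> 0}"

definition empty_partition :: "nat \<Rightarrow> nat" where
  "empty_partition = (\<lambda>_. 0)"

definition psize :: "(nat \<Rightarrow> nat) \<Rightarrow> nat" where
  "psize lam = (\<Sum>i | lam i \<noteq> 0. lam i)"

definition conjugate :: "(nat \<Rightarrow> nat) \<Rightarrow> nat \<Rightarrow> nat" where
  "conjugate lam j = card {i. lam i > j}"

definition remove_first_row :: "(nat \<Rightarrow> nat) \<Rightarrow> nat \<Rightarrow> nat" where
  "remove_first_row lam = (\<lambda>i. lam (Suc i))"

definition horizontal_strip :: "(nat \<Rightarrow> nat) \<Rightarrow> (nat \<Rightarrow> nat) \<Rightarrow> bool" where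
  "horizontal_strip lam mu \<longleftrightarrow> (\<forall>i. lam i \<ge> mu i \<and> mu i \<ge> lam (Suc i))"

definition skew_cells :: "(nat \<Rightarrow> nat) \<Rightarrow> (nat \<Rightarrow> nat) \<Rightarrow> (nat \<times> nat) set" where
  "skew_cells lam mu = {(i, j). mu i \<le> j \<and> j < lam i}"

definition skew_rows :: "(nat \<Rightarrow> nat) \<Rightarrow> (nat \<Rightarrow> nat) \<Rightarrow> nat" where
  "skew_rows lam mu = card {i. lam i > mu i}"

definition skew_cols :: "(nat \<Rightarrow> nat) \<Rightarrow> (nat \<Rightarrow> nat) \<Rightarrow> nat" where
  "skew_cols lam mu = card (snd ` skew_cells lam mu)"

definition edge_adjacent :: "nat \<times> nat \<Rightarrow> nat \<times> nat \<Rightarrow> bool" where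
  "edge_adjacent p q \<longleftrightarrow>
     (fst p = fst q \<and> (snd p = Suc (snd q) \<or> snd q = Suc (snd p))) \<or>
     (snd p = snd q \<and> (fst p = Suc (fst q) \<or> fst q = Suc (fst p)))"

definition skew_components :: "(nat \<Rightarrow> nat) \<Rightarrow> (nat \<Rightarrow> nat) \<Rightarrow> nat" where
  "skew_components lam mu =
     (let D = skew_cells lam mu
      in card (D // {(p, q). p \<in> D \<and> q \<in> D \<and> edge_adjacent p q}\<^sup>*))"

text \<open>The sums over \<open>mu\<close> in the two recursions below are finite.\<close>

lemma finite_subpartitions:
  assumes "is_partition lam"
  shows "finite {mu. is_partition mu \<and> mu \<le> lam}"
proof -
  let ?A = "{i. lam i \<noteq> 0}"
  have fin: "finite ?A" using assms by (simp add: is_partition_def)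
  have "{mu. is_partition mu \<and> mu \<le> lam}
      \<subseteq> {mu. \<forall>i. (i \<in> ?A \<longrightarrow> mu i \<in> {..lam 0}) \<and> (i \<notin> ?A \<longrightarrow> mu i = 0)}"
  proof (clarify, intro conjI impI)
    fix mu i assume le: "mu \<le> lam"
    have "mu i \<le> lam i" using le by (simp add: le_fun_def)
    also have "lam i \<le> lam 0" using assms by (simp add: is_partition_def antimono_def)
    finally show "mu i \<in> {..lam 0}" by simp
    assume "i \<notin> ?A"
    with le show "mu i = 0" by (simp add: le_fun_def) (metis le_zero_eq)
  qed
  moreover have "finite {mu. \<forall>i. (i \<in> ?A \<longrightarrow> mu i \<in> {..lam 0}) \<and> (i \<notin> ?A \<longrightarrow> mu i = 0)}"
    by (rule finite_set_of_finite_funs[OF fin]) simp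
  ultimately show ?thesis by (rule finite_subset)
qed

lemma finite_horizontal_strips:
  assumes "is_partition lam"
  shows "finite {mu. is_partition mu \<and> horizontal_strip lam mu}"
  by (rule finite_subset[OF _ finite_subpartitions[OF assms]])
    (auto simp: horizontal_strip_def le_fun_def)

section \<open>Canonical Grothendieck polynomials and their duals\<close>

text \<open>
  The argument \<open>n\<close> is the number of variables, which are \<open>x 1, \<dots>, x n\<close>.
\<close>

primrec canonical_G ::
  "'b \<Rightarrow> 'b \<Rightarrow> (nat \<Rightarrow> 'b) \<Rightarrow> nat \<Rightarrow> (nat \<Rightarrow> nat) \<Rightarrow> 'b :: {comm_ring_1, inverse}" where
  "canonical_G \<alpha> \<beta> x 0 lam = (if lam = empty_partition then 1 else 0)"
| "canonical_G \<alpha> \<beta> x (Suc n) lam =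
     (\<Sum>mu | is_partition mu \<and> horizontal_strip lam mu.
        canonical_G \<alpha> \<beta> x n mu
        * (x (Suc n) / (1 - \<alpha> * x (Suc n))) ^ (psize lam - psize mu)
        * ((1 + \<beta> * x (Suc n)) / (1 - \<alpha> * x (Suc n)))
            ^ skew_rows mu (remove_first_row lam))"

text \<open>
  The subtractions of natural numbers do not truncate: distinct components of a skew shape
  have no row or column in common, and a component with \<open>r\<close> rows and \<open>c\<close> columns
  has at least \<open>r + c - 1\<close> cells.
\<close>

primrec dual_g ::
  "'b \<Rightarrow> 'b \<Rightarrow> (nat \<Rightarrow> 'b) \<Rightarrow> nat \<Rightarrow> (nat \<Rightarrow> nat) \<Rightarrow> 'b :: comm_ring_1" where
  "dual_g \<alpha> \<beta> x 0 lam = (if lam = empty_partition then 1 else 0)"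
| "dual_g \<alpha> \<beta> x (Suc n) lam =
     (\<Sum>mu | is_partition mu \<and> mu \<le> lam.
        let r = skew_rows lam mu; c = skew_cols lam mu; b = skew_components lam mu
        in dual_g \<alpha> \<beta> x n mu
           * \<beta> ^ (r - b)
           * (\<alpha> + \<beta>) ^ ((psize lam + b) - (psize mu + r + c))
           * x (Suc n) ^ b
           * (\<alpha> + x (Suc n)) ^ (c - b))"

end

theory Submission
  imports Defs
begin

text \<open>
  Write \<open>L = \<lambda>'\<close>, \<open>t = x / (1 + \<beta>x)\<close> and \<open>s = (1 - \<alpha>x) / (1 + \<beta>x) = 1 - (\<alpha> + \<beta>)t\<close>, and let
  \<open>w(L/N)\<close>, \<open>g(L/M)\<close> be the weights of one step of the two recursions in the variables \<open>x\<close>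
  and \<open>y\<close>. By induction on both numbers of variables the theorem reduces to the skew identity
  \<open>\<Sum>\<^sub>L w(L/N) g(L/M) = (1 + xy) \<Sum>\<^sub>K w(M/K) g(N/K)\<close>.
  For fixed \<open>M\<close> and \<open>N\<close> the interlacing conditions bound the rows of \<open>L\<close>, and those of \<open>K\<close>,
  independently of each other. Moreover \<open>g\<close> is a product over rows, in which the overlap of two
  adjacent rows may be attributed to either of them, so both sums factor over rows. The
  corresponding factors agree up to a gauge factor \<open>\<phi>(M\<^sub>i, N\<^sub>i) / \<phi>(M\<^sub>i\<^sub>+\<^sub>1, N\<^sub>i\<^sub>+\<^sub>1)\<close> whose
  product telescopes; the first row of \<open>L\<close> contributes \<open>(1 + xy) \<phi>(M\<^sub>0, N\<^sub>0)\<close>.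
  Infinite sums are handled modulo the series that vanish in degrees below \<open>k\<close>.
\<close>

section \<open>Identities for a single row\<close>

lemma sum_top_factor:
  fixes g :: "nat \<Rightarrow> 'r :: comm_ring_1"
  assumes "u \<le> d"
  shows "(\<Sum>l=u..d. g l * (if l < d then s else 1)) = s * (\<Sum>l=u..<d. g l) + g d"
proof -
  have "(\<Sum>l=u..d. g l * (if l < d then s else 1))
      = (\<Sum>l=u..<d. g l * (if l < d then s else 1)) + g d"
    using assms by (simp add: sum.last_plus add.commute)
  also have "(\<Sum>l=u..<d. g l * (if l < d then s else 1)) = s * (\<Sum>l=u..<d. g l)"
    by (simp add: sum_distrib_left mult.commute)
  finally show ?thesis .
qed

text \<open>\<open>t\<close> stands for \<open>x / (1 + \<beta> * x)\<close> and \<open>z\<close>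
  for \<open>y / (1 - \<beta> * t + t * y)\<close>; stated as equations, both make sense in any
  commutative ring.\<close>

locale cauchy_parameters =
  fixes \<alpha> \<beta> x y t z :: "'r :: comm_ring_1"
  assumes t_eq: "t * (1 + \<beta> * x) = x"
    and z_eq: "z * (1 - \<beta> * t + t * y) = y"
begin

definition s :: 'r where "s = 1 - (\<alpha> + \<beta>) * t"

definition geo :: "nat \<Rightarrow> 'r" where "geo m = (\<Sum>j<m. (\<beta> * t) ^ j)"

text \<open>
  The dual step weight of \<open>L/M\<close> is a product over rows. The first weight below attributes the
  overlap of two adjacent rows to the lower one and is
  \<open>upper_weight (M (i + 1)) (M i) (L (i + 1))\<close>; the second attributes it to the upper one
  and is \<open>lower_weight (L i) (L (i + 1)) (M i)\<close>. Thus one of them involves a single row of \<open>L\<close>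
  and the other a single row of \<open>M\<close>.
\<close>

definition upper_weight :: "nat \<Rightarrow> nat \<Rightarrow> nat \<Rightarrow> 'r" where
  "upper_weight a b l =
     (if l = a then 1
      else if l \<le> b then y * \<beta> ^ (l - a - 1)
      else \<beta> ^ (b - a) * (\<alpha> + \<beta>) ^ (l - b - 1) * (\<alpha> + y))"

definition lower_weight :: "nat \<Rightarrow> nat \<Rightarrow> nat \<Rightarrow> 'r" where
  "lower_weight d c k =
     (if k = d then 1
      else if c \<le> k then y * \<beta> ^ (d - k - 1)
      else \<beta> ^ (d - c) * (\<alpha> + \<beta>) ^ (c - k - 1) * (\<alpha> + y))"

text \<open>The common value of the two weights when there is no overlap:
  \<open>upper_weight a b l\<close> for \<open>l \<le> b\<close>, and
  \<open>lower_weight l c a\<close> for \<open>c \<le> a\<close>.\<close>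

definition row_weight :: "nat \<Rightarrow> nat \<Rightarrow> 'r" where
  "row_weight l a = (if l = a then 1 else y * \<beta> ^ (l - a - 1))"

text \<open>
  Up to the factor \<open>1 + x * y\<close>, this is the sum over the first row of \<open>L\<close>, which is the
  only row that the strip condition leaves unbounded.
\<close>

definition gauge :: "nat \<Rightarrow> nat \<Rightarrow> 'r" where
  "gauge b d = (if d \<le> b then t ^ (b - d) else z * \<beta> ^ (d - b - 1))"

text \<open>Here \<open>a\<close>, \<open>b\<close> are rows i + 1 and i of \<open>M\<close>, and
  \<open>c\<close>, \<open>d\<close> those of \<open>N\<close>. This is the factor of row i + 1 of
  \<open>L\<close>; \<open>lower_sum\<close> is that of row i of \<open>K\<close>.\<close>

definition upper_sum :: "nat \<Rightarrow> nat \<Rightarrow> nat \<Rightarrow> nat \<Rightarrow> 'r" where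
  "upper_sum a b c d =
     (\<Sum>l=max a c..d. upper_weight a b l * t ^ (l - c) * (if l < d then s else 1))"

definition lower_sum :: "nat \<Rightarrow> nat \<Rightarrow> nat \<Rightarrow> nat \<Rightarrow> 'r" where
  "lower_sum a b c d =
     (\<Sum>k=a..min b d. lower_weight d c k * t ^ (b - k) * (if a < k then s else 1))"

lemma geo_0 [simp]: "geo 0 = 0"
  and geo_Suc: "geo (Suc m) = geo m + (\<beta> * t) ^ m"
  by (simp_all add: geo_def)

lemma geo_eq: "(1 - \<beta> * t) * geo m = 1 - (\<beta> * t) ^ m"
proof (induction m)
  case (Suc m)
  then show ?case by (simp only: geo_Suc distrib_left) (simp add: left_diff_distrib)
qed simp

lemma one_minus_inverse: "(1 - \<beta> * t) * (1 + \<beta> * x) = 1"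
proof -
  have "(1 - \<beta> * t) * (1 + \<beta> * x) = 1 + \<beta> * x - \<beta> * (t * (1 + \<beta> * x))"
    by (simp add: algebra_simps)
  then show ?thesis by (simp add: t_eq)
qed

lemma x_eq: "x * (1 - \<beta> * t) = t"
proof -
  have "x * (1 - \<beta> * t) = t * ((1 - \<beta> * t) * (1 + \<beta> * x))"
    by (subst t_eq[symmetric]) (simp add: ac_simps)
  then show ?thesis by (simp add: one_minus_inverse)
qed

text \<open>Since \<open>1 - \<beta> * t\<close> inverts \<open>1 + \<beta> * x\<close>, the
  denominator of \<open>z\<close> is \<open>(1 + x * y) / (1 + \<beta> * x)\<close>.\<close>

lemma z_one_plus: "(1 + x * y) * z = y * (1 + \<beta> * x)"
proof -
  have "(1 - \<beta> * t + t * y) * (1 + \<beta> * x)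
      = (1 - \<beta> * t) * (1 + \<beta> * x) + t * (1 + \<beta> * x) * y"
    by (simp add: algebra_simps)
  then have "1 + x * y = (1 - \<beta> * t + t * y) * (1 + \<beta> * x)"
    by (simp only: one_minus_inverse t_eq)
  then have "(1 + x * y) * z = (z * (1 - \<beta> * t + t * y)) * (1 + \<beta> * x)"
    by (simp only: ac_simps)
  then show ?thesis by (simp only: z_eq)
qed

section \<open>Closed forms of the sum over one row of \<open>L\<close>\<close>

lemma sum_upper_short:
  assumes "c \<le> a" "a < d" "d \<le> Suc b"
  shows "(\<Sum>l=a..<d. upper_weight a b l * t ^ (l - c)) = t ^ (a - c) * (1 + y * t * geo (d - a - 1))"
proof -
  have "a + Suc m \<le> Suc b \<Longrightarrow> (\<Sum>l=a..<a + Suc m. upper_weight a b l * t ^ (l - c))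
      = t ^ (a - c) * (1 + y * t * geo m)" for m
  proof (induction m)
    case 0
    then show ?case by (simp add: upper_weight_def)
  next
    case (Suc m)
    have "a + Suc m - c = (a - c) + Suc m" using assms by simp
    moreover from Suc.prems have "upper_weight a b (a + Suc m) = y * \<beta> ^ m"
      by (simp add: upper_weight_def)
    ultimately have "upper_weight a b (a + Suc m) * t ^ (a + Suc m - c)
        = t ^ (a - c) * (y * t * (\<beta> * t) ^ m)"
      by (simp only: power_add power_mult_distrib power_Suc) (simp only: ac_simps)
    with Suc show ?case by (simp add: geo_Suc algebra_simps)
  qed
  from this[of "d - a - 1"] assms show ?thesis by simp
qed

lemma sum_upper_middle:
  assumes "a < c" "c \<le> d" "d \<le> Suc b"
  shows "(\<Sum>l=c..<d. upper_weight a b l * t ^ (l - c)) = y * \<beta> ^ (c - a - 1) * geo (d - c)"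
proof -
  have "c + m \<le> Suc b \<Longrightarrow> (\<Sum>l=c..<c + m. upper_weight a b l * t ^ (l - c))
      = y * \<beta> ^ (c - a - 1) * geo m" for m
  proof (induction m)
    case 0
    then show ?case by simp
  next
    case (Suc m)
    have "c + m - a - 1 = (c - a - 1) + m" using assms by simp
    with Suc.prems assms have "upper_weight a b (c + m) = y * \<beta> ^ (c - a - 1) * \<beta> ^ m"
      by (simp add: upper_weight_def mult.assoc flip: power_add)
    with Suc show ?case by (simp add: geo_Suc algebra_simps power_mult_distrib)
  qed
  from this[of "d - c"] assms show ?thesis by simp
qed

text \<open>Beyond \<open>b\<close> the terms are geometric of ratio
  \<open>(\<alpha> + \<beta>) * t\<close>, and \<open>s\<close> is exactly one minus this ratio. So
  the expression telescopes to its first term, whatever \<open>d\<close> is.\<close>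

lemma sum_upper_long:
  assumes "a \<le> b" "b < u" "c \<le> u" "u \<le> d"
  shows "s * (\<Sum>l=u..<d. upper_weight a b l * t ^ (l - c)) + upper_weight a b d * t ^ (d - c)
      = \<beta> ^ (b - a) * (\<alpha> + y) * (\<alpha> + \<beta>) ^ (u - b - 1) * t ^ (u - c)"
proof -
  have w: "upper_weight a b (u + m) * t ^ (u + m - c)
     = \<beta> ^ (b - a) * (\<alpha> + y) * (\<alpha> + \<beta>) ^ (u - b - 1) * t ^ (u - c) * ((\<alpha> + \<beta>) * t) ^ m" for m
  proof -
    have "u + m - b - 1 = (u - b - 1) + m" "u + m - c = (u - c) + m" using assms by simp_all
    moreover have "upper_weight a b (u + m) = \<beta> ^ (b - a) * (\<alpha> + \<beta>) ^ (u + m - b - 1) * (\<alpha> + y)"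
      using assms by (simp add: upper_weight_def)
    ultimately show ?thesis by (simp only: power_add power_mult_distrib ac_simps)
  qed
  have "s * (\<Sum>l=u..<u + m. upper_weight a b l * t ^ (l - c)) + upper_weight a b (u + m) * t ^ (u + m - c)
      = \<beta> ^ (b - a) * (\<alpha> + y) * (\<alpha> + \<beta>) ^ (u - b - 1) * t ^ (u - c)" for m
  proof (induction m)
    case 0
    show ?case using w[of 0] by simp
  next
    case (Suc m)
    have "s * (upper_weight a b (u + m) * t ^ (u + m - c))
          + upper_weight a b (u + Suc m) * t ^ (u + Suc m - c)
        = upper_weight a b (u + m) * t ^ (u + m - c)"
      by (simp only: w s_def) (simp add: algebra_simps)
    with Suc.IH show ?case
      by (simp only: add_Suc_right sum.atLeastLessThan_Suc le_add1 distrib_left add.assoc)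
  qed
  from this[of "d - u"] assms show ?thesis by simp
qed

lemma upper_sum_split:
  assumes "a \<le> d" "c \<le> d"
  shows "upper_sum a b c d = s * (\<Sum>l=max a c..<d. upper_weight a b l * t ^ (l - c))
     + upper_weight a b d * t ^ (d - c)"
  unfolding upper_sum_def using assms by (intro sum_top_factor) simp

text \<open>The order of \<open>a\<close> and \<open>c\<close> decides where the range begins, and
  that of \<open>b\<close> and \<open>d\<close> whether it crosses \<open>b\<close>, where the
  weight changes shape. This gives four cases; in the fifth, \<open>b < c\<close>, the range lies
  wholly beyond \<open>b\<close>.\<close>

lemma upper_sum_inside:
  assumes "c \<le> a" "a \<le> d" "d \<le> b"
  shows "upper_sum a b c d = t ^ (a - c) *
    (if a = d then 1 else s * (1 + y * t * geo (d - a - 1)) + y * t * (\<beta> * t) ^ (d - a - 1))"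
proof (cases "a = d")
  case True
  then show ?thesis using assms by (simp add: upper_sum_split upper_weight_def max_def)
next
  case False
  then have "t ^ (d - c) = t ^ (a - c) * (t * t ^ (d - a - 1))"
    using assms by (simp add: Suc_diff_Suc flip: power_Suc power_add)
  moreover have "upper_weight a b d = y * \<beta> ^ (d - a - 1)"
    using False assms by (simp add: upper_weight_def)
  moreover have "max a c = a" using assms by simp
  ultimately show ?thesis using False assms
    by (simp add: upper_sum_split sum_upper_short) (simp add: algebra_simps power_mult_distrib)
qed

lemma upper_sum_over:
  assumes "c \<le> a" "a \<le> b" "b < d"
  shows "upper_sum a b c d = t ^ (a - c) *
    (s * (1 + y * t * geo (b - a)) + t * (\<beta> * t) ^ (b - a) * (\<alpha> + y))"
proof -
  let ?g = "\<lambda>l. upper_weight a b l * t ^ (l - c)"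
  have "upper_sum a b c d = s * (\<Sum>l=a..<Suc b. ?g l) + (s * (\<Sum>l=Suc b..<d. ?g l) + ?g d)"
    using assms sum.atLeastLessThan_concat[of a "Suc b" d ?g, symmetric]
    by (simp add: upper_sum_split max_def algebra_simps)
  also have "s * (\<Sum>l=Suc b..<d. ?g l) + ?g d = \<beta> ^ (b - a) * (\<alpha> + y) * t ^ (Suc b - c)"
    using assms by (subst sum_upper_long) auto
  also have "t ^ (Suc b - c) = t ^ (a - c) * (t * t ^ (b - a))"
    using assms by (simp add: Suc_diff_le flip: power_Suc power_add)
  also have "(\<Sum>l=a..<Suc b. ?g l) = t ^ (a - c) * (1 + y * t * geo (b - a))"
    using assms by (subst sum_upper_short) auto
  finally show ?thesis by (simp add: algebra_simps power_mult_distrib)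
qed

lemma upper_sum_under:
  assumes "a < c" "c \<le> d" "d \<le> b"
  shows "upper_sum a b c d = y * \<beta> ^ (c - a - 1) * (s * geo (d - c) + (\<beta> * t) ^ (d - c))"
proof -
  have "d - a - 1 = (c - a - 1) + (d - c)" using assms by simp
  then have "upper_weight a b d = y * (\<beta> ^ (c - a - 1) * \<beta> ^ (d - c))"
    using assms by (simp add: upper_weight_def flip: power_add)
  then show ?thesis using assms
    by (simp add: upper_sum_split max_def sum_upper_middle)
       (simp add: algebra_simps power_mult_distrib)
qed

lemma upper_sum_across:
  assumes "a < c" "c \<le> b" "b < d"
  shows "upper_sum a b c d = \<beta> ^ (c - a - 1) *
    (y * s * geo (Suc (b - c)) + (\<beta> * t) ^ Suc (b - c) * (\<alpha> + y))"
proof -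
  let ?g = "\<lambda>l. upper_weight a b l * t ^ (l - c)"
  have "upper_sum a b c d = s * (\<Sum>l=c..<Suc b. ?g l) + (s * (\<Sum>l=Suc b..<d. ?g l) + ?g d)"
    using assms sum.atLeastLessThan_concat[of c "Suc b" d ?g, symmetric]
    by (simp add: upper_sum_split max_def algebra_simps)
  also have "s * (\<Sum>l=Suc b..<d. ?g l) + ?g d = \<beta> ^ (b - a) * (\<alpha> + y) * t ^ (Suc b - c)"
    using assms by (subst sum_upper_long) auto
  also have "\<beta> ^ (b - a) = \<beta> ^ (c - a - 1) * \<beta> ^ Suc (b - c)"
    using assms by (simp add: Suc_diff_Suc flip: power_Suc power_add)
  also have "Suc b - c = Suc (b - c)" using assms by simp
  also have "(\<Sum>l=c..<Suc b. ?g l) = y * \<beta> ^ (c - a - 1) * geo (Suc (b - c))"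
    using assms by (subst sum_upper_middle) (auto simp: Suc_diff_le)
  finally show ?thesis by (simp only: power_mult_distrib distrib_left ac_simps)
qed

lemma upper_sum_beyond:
  assumes "a \<le> b" "b < c" "c \<le> d"
  shows "upper_sum a b c d = \<beta> ^ (b - a) * (\<alpha> + y) * (\<alpha> + \<beta>) ^ (c - b - 1)"
proof -
  have "max a c = c" using assms by simp
  then show ?thesis using assms sum_upper_long[of a b c c d] by (simp add: upper_sum_split)
qed

text \<open>Replacing every length \<open>j\<close> by \<open>T - j\<close> exchanges the two
  attributions of the overlap and the roles of \<open>M\<close> and \<open>N\<close>. Each closed
  form of \<open>upper_sum\<close> thus gives one of \<open>lower_sum\<close>.\<close>

lemma lower_sum_reflect:
  assumes "a \<le> b" "c \<le> d" "b \<le> T" "d \<le> T"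
  shows "lower_sum a b c d = upper_sum (T - d) (T - c) (T - b) (T - a)"
  unfolding lower_sum_def upper_sum_def
proof (rule sum.reindex_bij_witness[where i = "\<lambda>l. T - l" and j = "\<lambda>k. T - k"])
  fix k assume k: "k \<in> {a..min b d}"
  have "lower_weight d c k = upper_weight (T - d) (T - c) (T - k)"
    using assms k by (auto simp: lower_weight_def upper_weight_def)
  moreover have "(T - k < T - a) = (a < k)" "T - k - (T - b) = b - k"
    using assms k by auto
  ultimately show "upper_weight (T - d) (T - c) (T - k) * t ^ (T - k - (T - b)) *
      (if T - k < T - a then s else 1) = lower_weight d c k * t ^ (b - k) * (if a < k then s else 1)"
    by simp
qed (use assms in auto)

text \<open>The denominator of \<open>z\<close> carries the bracket of
  \<open>upper_sum_under\<close> to that of \<open>upper_sum_over\<close>: the geometric sum closes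
  up against \<open>1 - \<beta> * t\<close>, and the rest combines by the definition of
  \<open>s\<close>.\<close>

lemma upper_under_over:
  "y * (s * geo m + (\<beta> * t) ^ m) = z * (s * (1 + y * t * geo m) + t * (\<beta> * t) ^ m * (\<alpha> + y))"
proof -
  let ?p = "(\<beta> * t) ^ m"
  have "(1 - \<beta> * t + t * y) * (s * geo m + ?p)
      = s * ((1 - \<beta> * t) * geo m) + t * y * s * geo m + (1 - \<beta> * t + t * y) * ?p"
    by (simp add: algebra_simps)
  also have "\<dots> = s * (1 + y * t * geo m) + t * ?p * (\<alpha> + y)"
    unfolding geo_eq by (simp add: s_def algebra_simps)
  finally have "(z * (1 - \<beta> * t + t * y)) * (s * geo m + ?p)
      = z * (s * (1 + y * t * geo m) + t * ?p * (\<alpha> + y))"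
    by (simp only: mult.assoc)
  then show ?thesis by (simp only: z_eq)
qed

text \<open>Reflection preserves the cases inside, across and beyond, and swaps under with over.
  Both sums therefore have matching closed forms, and the remaining powers of \<open>t\<close> and
  \<open>\<beta>\<close> and the factor \<open>z\<close> are those recorded by
  \<open>gauge\<close>.\<close>

lemma row_exchange:
  assumes "a \<le> b" "c \<le> d"
  shows "upper_sum a b c d * gauge b d = lower_sum a b c d * gauge a c"
proof (cases "a \<le> d")
  case False
  \<comment> \<open>For \<open>d < a\<close> both ranges are empty.\<close>
  then show ?thesis using assms by (simp add: upper_sum_def lower_sum_def)
next
  case True
  define T where "T = b + d"
  have T: "b \<le> T" "d \<le> T" by (simp_all add: T_def)
  note refl = lower_sum_reflect[OF assms T]
  consider "c \<le> a" "d \<le> b" | "c \<le> a" "b < d" | "a < c" "d \<le> b" | "a < c" "c \<le> b" "b < d" | "b < c"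
    by linarith
  then show ?thesis
  proof cases
    case 1
    have "T - a - (T - d) - 1 = d - a - 1" "(T - d = T - a) = (a = d)" "T - d - (T - b) = b - d"
      using True assms T 1 by auto
    then have "lower_sum a b c d = t ^ (b - d) * (if a = d then 1
        else s * (1 + y * t * geo (d - a - 1)) + y * t * (\<beta> * t) ^ (d - a - 1))"
      unfolding refl using True assms T 1 by (subst upper_sum_inside) auto
    moreover have "upper_sum a b c d = t ^ (a - c) * (if a = d then 1
        else s * (1 + y * t * geo (d - a - 1)) + y * t * (\<beta> * t) ^ (d - a - 1))"
      using True assms 1 by (subst upper_sum_inside) auto
    ultimately show ?thesis using 1 by (simp add: gauge_def)
  next
    case 2
    have e: "T - b - (T - d) - 1 = d - b - 1" "T - a - (T - b) = b - a"
      using True assms T 2 by auto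
    have "lower_sum a b c d = y * \<beta> ^ (d - b - 1) * (s * geo (b - a) + (\<beta> * t) ^ (b - a))"
      unfolding refl using True assms T 2 by (subst upper_sum_under) (auto simp only: e)
    also have "\<dots> = \<beta> ^ (d - b - 1) * (y * (s * geo (b - a) + (\<beta> * t) ^ (b - a)))"
      by (simp only: ac_simps)
    finally show ?thesis using 2 assms
      by (simp only: upper_under_over upper_sum_over gauge_def) (simp add: ac_simps)
  next
    case 3
    have e: "T - c - (T - d) = d - c" "T - d - (T - b) = b - d"
      using True assms T 3 by auto
    have "lower_sum a b c d = t ^ (b - d) *
      (s * (1 + y * t * geo (d - c)) + t * (\<beta> * t) ^ (d - c) * (\<alpha> + y))"
      unfolding refl using True assms T 3 by (subst upper_sum_over) (auto simp only: e)
    moreover have "upper_sum a b c d = \<beta> ^ (c - a - 1) * (y * (s * geo (d - c) + (\<beta> * t) ^ (d - c)))"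
      using assms 3 by (simp add: upper_sum_under ac_simps)
    ultimately show ?thesis using 3
      by (simp only: upper_under_over gauge_def) (simp add: ac_simps)
  next
    case 4
    have e: "T - b - (T - d) - 1 = d - b - 1" "T - c - (T - b) = b - c"
      using True assms T 4 by auto
    have "lower_sum a b c d = \<beta> ^ (d - b - 1) *
      (y * s * geo (Suc (b - c)) + (\<beta> * t) ^ Suc (b - c) * (\<alpha> + y))"
      unfolding refl using True assms T 4 by (subst upper_sum_across) (auto simp only: e)
    then show ?thesis using 4 by (simp only: upper_sum_across gauge_def) (simp add: ac_simps)
  next
    case 5
    have e: "T - b - (T - c) - 1 = c - b - 1" "T - c - (T - d) = d - c"
      using True assms T 5 by auto
    have l: "lower_sum a b c d = \<beta> ^ (d - c) * (\<alpha> + y) * (\<alpha> + \<beta>) ^ (c - b - 1)"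
      unfolding refl using True assms T 5 by (subst upper_sum_beyond) (auto simp only: e)
    \<comment> \<open>Both sides are \<open>d - a - 1\<close>.\<close>
    have "(b - a) + (d - b - 1) = (d - c) + (c - a - 1)" using assms 5 by simp
    then have p: "\<beta> ^ (b - a) * \<beta> ^ (d - b - 1) = \<beta> ^ (d - c) * \<beta> ^ (c - a - 1)"
      by (simp flip: power_add)
    have "upper_sum a b c d * gauge b d
        = (\<beta> ^ (b - a) * \<beta> ^ (d - b - 1)) * ((\<alpha> + y) * (\<alpha> + \<beta>) ^ (c - b - 1) * z)"
      using assms 5 by (simp add: upper_sum_beyond gauge_def ac_simps)
    also have "\<dots> = lower_sum a b c d * gauge a c"
      using assms 5 unfolding p l by (simp add: gauge_def ac_simps)
    finally show ?thesis .
  qed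
qed

text \<open>Divisibility replaces convergence: the full geometric series would give
  \<open>(1 + x * y) * gauge a d\<close>, and the tail cut off at \<open>T\<close> is divisible by
  this power of \<open>t\<close>.\<close>

lemma first_row_sum:
  assumes "a \<le> T" "d \<le> T"
  shows "t ^ (T + 1 - d) dvd
    (\<Sum>l=max a d..T. row_weight l a * t ^ (l - d)) - (1 + x * y) * gauge a d"
proof -
  \<comment> \<open>With \<open>T\<close> in the place of \<open>b\<close>, no row of the range is
    longer than \<open>b\<close>, so the closed forms above apply.\<close>
  have "(\<Sum>l=max a d..T. row_weight l a * t ^ (l - d))
      = (\<Sum>l=max a d..<Suc T. upper_weight a T l * t ^ (l - d))"
    by (intro sum.cong) (auto simp: row_weight_def upper_weight_def)
  note eq = this
  show ?thesis
  proof (cases "d \<le> a")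
    case True
    let ?n = "T - a"
    have "t * geo ?n = x * (1 - (\<beta> * t) ^ ?n)"
      by (metis geo_eq mult.assoc x_eq)
    then have e1: "y * t * geo ?n = x * y * (1 - (\<beta> * t) ^ ?n)"
      by (simp only: mult.assoc) (simp only: ac_simps)
    have e2: "(\<Sum>l=max a d..<Suc T. upper_weight a T l * t ^ (l - d))
        = t ^ (a - d) * (1 + y * t * geo ?n)"
      using True assms by (simp only: max_absorb1) (subst sum_upper_short, auto)
    have "(\<Sum>l=max a d..T. row_weight l a * t ^ (l - d)) - (1 + x * y) * gauge a d
       = - (t ^ (a - d) * x * y * (\<beta> * t) ^ ?n)"
      unfolding eq e2 e1 using True by (simp add: gauge_def algebra_simps)
    \<comment> \<open>Rewriting \<open>x\<close> supplies the last factor \<open>t\<close> needed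
      for the exponent \<open>T + 1 - d\<close>.\<close>
    also have "\<dots> = - (t ^ (a - d) * (t * (1 + \<beta> * x)) * y * (\<beta> * t) ^ ?n)"
      by (simp only: t_eq)
    also have "\<dots> = (t ^ (a - d) * t * t ^ ?n) * - ((1 + \<beta> * x) * y * \<beta> ^ ?n)"
      by (simp only: power_mult_distrib ac_simps mult_minus_right)
    also have "t ^ (a - d) * t * t ^ ?n = t ^ (T + 1 - d)"
    proof -
      have "a - d + 1 + ?n = T + 1 - d" using True assms by simp
      then show ?thesis by (metis power_add power_one_right)
    qed
    finally show ?thesis by simp
  next
    case False
    let ?n = "T + 1 - d"
    have "(1 + \<beta> * x) * ((1 - \<beta> * t) * geo ?n) = ((1 - \<beta> * t) * (1 + \<beta> * x)) * geo ?n"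
      by (simp only: ac_simps)
    then have g: "geo ?n = (1 + \<beta> * x) * (1 - (\<beta> * t) ^ ?n)"
      by (simp only: one_minus_inverse geo_eq mult_1_left)
    have "(\<Sum>l=max a d..<Suc T. upper_weight a T l * t ^ (l - d)) = y * \<beta> ^ (d - a - 1) * geo ?n"
      using sum_upper_middle[of a d "Suc T" T] False assms by (simp only: max_absorb2) simp
    moreover have "(1 + x * y) * gauge a d = y * (1 + \<beta> * x) * \<beta> ^ (d - a - 1)"
      using False by (simp only: gauge_def if_False z_one_plus mult.assoc[symmetric])
    ultimately have "(\<Sum>l=max a d..T. row_weight l a * t ^ (l - d)) - (1 + x * y) * gauge a d
       = - (y * \<beta> ^ (d - a - 1) * (1 + \<beta> * x) * (\<beta> * t) ^ ?n)"
      unfolding eq by (simp only: g) (simp add: algebra_simps)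
    also have "\<dots> = t ^ ?n * - (y * \<beta> ^ (d - a - 1) * (1 + \<beta> * x) * \<beta> ^ ?n)"
      by (simp only: power_mult_distrib ac_simps mult_minus_right)
    finally show ?thesis by simp
  qed
qed

text \<open>Primes denote the next lower row. If the rows overlap, \<open>M < L'\<close>, both sides
  carry the same overlap factor and the same total power of \<open>\<beta>\<close>; otherwise all
  four weights are row weights.\<close>

lemma lower_upper_exchange:
  assumes "M' \<le> M" "M \<le> L" "M' \<le> L'" "L' \<le> L"
  shows "lower_weight L L' M * row_weight L' M' = row_weight L M * upper_weight M' M L'"
proof (cases "L' \<le> M")
  case True
  then show ?thesis using assms
    by (auto simp: lower_weight_def row_weight_def upper_weight_def)
next
  case False
  have "(L - L') + (L' - M' - 1) = (L - M - 1) + (M - M')" using False assms by simp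
  then have "\<beta> ^ (L - L') * \<beta> ^ (L' - M' - 1) = \<beta> ^ (L - M - 1) * \<beta> ^ (M - M')"
    by (simp flip: power_add)
  then have "(\<beta> ^ (L - L') * \<beta> ^ (L' - M' - 1)) * (y * (\<alpha> + \<beta>) ^ (L' - M - 1) * (\<alpha> + y))
    = (\<beta> ^ (L - M - 1) * \<beta> ^ (M - M')) * (y * (\<alpha> + \<beta>) ^ (L' - M - 1) * (\<alpha> + y))"
    by (rule arg_cong)
  then show ?thesis using False assms
    by (simp add: lower_weight_def row_weight_def upper_weight_def ac_simps)
qed

end

section \<open>Partitions, conjugation and skew shapes\<close>

lemma nat_eq_if_less_iff: "(\<And>j. j < a \<longleftrightarrow> j < b) \<Longrightarrow> a = b" for a b :: nat
  by (metis linorder_neqE_nat less_irrefl)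

lemma is_partition_antimono: "is_partition lam \<Longrightarrow> i \<le> j \<Longrightarrow> lam j \<le> lam i"
  by (simp add: is_partition_def antimono_def)

lemma is_partition_eventually_0:
  assumes "is_partition lam"
  obtains n where "\<And>i. i \<ge> n \<Longrightarrow> lam i = 0"
proof -
  from assms have "finite {i. lam i \<noteq> 0}" by (simp add: is_partition_def)
  then obtain n where "\<forall>i\<in>{i. lam i \<noteq> 0}. i < n" using finite_nat_set_iff_bounded by blast
  then show thesis by (intro that[of n]) force
qed

lemma is_partitionI:
  assumes "\<And>i. lam (Suc i) \<le> lam i" "\<And>i. i \<ge> n \<Longrightarrow> lam i = 0"
  shows "is_partition lam"
  unfolding is_partition_def
proof
  show "antimono lam" using assms(1) by (simp add: antimono_iff_le_Suc)
  have "{i. lam i \<noteq> 0} \<subseteq> {..<n}" using assms(2) by (auto intro: ccontr)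
  then show "finite {i. lam i \<noteq> 0}" by (rule finite_subset) simp
qed

lemma is_partition_empty [simp]: "is_partition empty_partition"
  by (rule is_partitionI) (auto simp: empty_partition_def)

text \<open>The rows longer than \<open>i\<close> form an initial segment, ending before the first
  row \<open>k\<close> of length at most \<open>i\<close>. This symmetric criterion drives the facts
  on conjugates below.\<close>

lemma less_conjugate_iff:
  assumes "is_partition lam"
  shows "j < conjugate lam i \<longleftrightarrow> i < lam j"
proof -
  obtain n where n: "\<And>i. i \<ge> n \<Longrightarrow> lam i = 0" using is_partition_eventually_0[OF assms] by blast
  define k where "k = (LEAST k. lam k \<le> i)"
  have "lam n \<le> i" using n by simp
  then have "lam k \<le> i" unfolding k_def by (rule LeastI)
  then have "i < lam j \<longleftrightarrow> j < k" for j
    using is_partition_antimono[OF assms, of k j] not_less_Least[of j "\<lambda>k. lam k \<le> i"]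
    by (auto simp: k_def[symmetric] not_le[symmetric])
  then have "{k. lam k > i} = {..<k}" by auto
  then have "conjugate lam i = k" "j < k \<longleftrightarrow> i < lam j" by (auto simp: conjugate_def)
  then show ?thesis by simp
qed

lemma is_partition_conjugate:
  assumes "is_partition lam"
  shows "is_partition (conjugate lam)"
proof (rule is_partitionI)
  show "conjugate lam (Suc i) \<le> conjugate lam i" for i
    by (rule leI) (metis Suc_lessD less_conjugate_iff[OF assms] less_irrefl)
  show "conjugate lam i = 0" if "i \<ge> lam 0" for i
    using that less_conjugate_iff[OF assms, of 0 i] by simp
qed

lemma conjugate_conjugate:
  assumes "is_partition lam"
  shows "conjugate (conjugate lam) = lam"
  by (rule ext, rule nat_eq_if_less_iff)
     (simp add: less_conjugate_iff assms is_partition_conjugate)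

lemma conjugate_le_iff:
  assumes "is_partition lam" "is_partition mu"
  shows "conjugate mu \<le> conjugate lam \<longleftrightarrow> mu \<le> lam"
proof -
  have "mu \<le> lam \<longleftrightarrow> (\<forall>i j. j < mu i \<longrightarrow> j < lam i)" for mu lam :: "nat \<Rightarrow> nat"
    by (auto simp: le_fun_def intro: order.strict_trans2) (meson leI less_irrefl)
  then show ?thesis using assms by (auto simp: less_conjugate_iff)
qed

lemma conjugate_empty [simp]: "conjugate empty_partition = empty_partition"
  by (simp add: conjugate_def empty_partition_def fun_eq_iff)

lemma psize_eq_sum:
  assumes "\<And>i. i \<ge> n \<Longrightarrow> lam i = 0"
  shows "psize lam = (\<Sum>i<n. lam i)"
proof -
  have "{i. lam i \<noteq> 0} \<subseteq> {..<n}" using assms by (auto intro: ccontr)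
  then show ?thesis unfolding psize_def by (intro sum.mono_neutral_left) auto
qed

lemma psize_empty [simp]: "psize empty_partition = 0"
  by (simp add: psize_def empty_partition_def)

lemma psize_conjugate:
  assumes "is_partition lam"
  shows "psize (conjugate lam) = psize lam"
proof -
  have card: "psize mu = card {(i, j). j < mu i}" if "is_partition mu" for mu
  proof -
    have "{(i, j). j < mu i} = (SIGMA i:{i. mu i \<noteq> 0}. {..<mu i})" by auto
    then show ?thesis using that by (simp add: psize_def is_partition_def)
  qed
  have "{(i, j). j < conjugate lam i} = prod.swap ` {(i, j). j < lam i}"
    by (auto simp: less_conjugate_iff assms image_iff)
  then show ?thesis
    using assms by (simp add: card is_partition_conjugate card_image inj_on_def)
qed

lemma psize_mono:
  assumes "is_partition lam" "mu \<le> lam"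
  shows "psize mu \<le> psize lam"
proof -
  obtain n where n: "\<And>i. i \<ge> n \<Longrightarrow> lam i = 0"
    using is_partition_eventually_0[OF assms(1)] by blast
  moreover have "\<And>i. i \<ge> n \<Longrightarrow> mu i = 0" using n assms(2) by (metis le_funD le_zero_eq)
  ultimately show ?thesis using assms(2) by (simp add: psize_eq_sum[of n] le_funD sum_mono)
qed

lemma finite_partitions_psize_less: "finite {lam. is_partition lam \<and> psize lam < k}"
proof (rule finite_subset)
  show "{lam. is_partition lam \<and> psize lam < k}
    \<subseteq> {lam. \<forall>i. (i \<in> {..<k} \<longrightarrow> lam i \<in> {..k}) \<and> (i \<notin> {..<k} \<longrightarrow> lam i = 0)}"
  proof (clarify, intro conjI impI)
    fix lam :: "nat \<Rightarrow> nat" and i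
    assume lam: "is_partition lam" and k: "psize lam < k"
    have fin: "finite {i. lam i \<noteq> 0}" using lam by (simp add: is_partition_def)
    have "lam i \<le> psize lam"
    proof (cases "lam i = 0")
      case False
      then show ?thesis unfolding psize_def by (intro member_le_sum[OF _ _ fin]) auto
    qed simp
    then show "lam i \<in> {..k}" using k by simp
    show "lam i = 0" if "i \<notin> {..<k}"
    proof (rule ccontr)
      assume "lam i \<noteq> 0"
      \<comment> \<open>A nonzero row \<open>i\<close> forces \<open>i + 1\<close> nonzero rows,
        hence size at least \<open>i + 1\<close>.\<close>
      then have "{..i} \<subseteq> {i. lam i \<noteq> 0}" using is_partition_antimono[OF lam, of _ i] by fastforce
      then have "(\<Sum>j\<le>i. lam j) \<le> psize lam"
        unfolding psize_def by (intro sum_mono2 fin) auto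
      moreover have "(\<Sum>j\<le>i. 1) \<le> (\<Sum>j\<le>i. lam j)"
        using \<open>lam i \<noteq> 0\<close> is_partition_antimono[OF lam, of _ i]
        by (intro sum_mono) fastforce
      ultimately show False using k that by simp
    qed
  qed
  show "finite {lam :: nat \<Rightarrow> nat. \<forall>i. (i \<in> {..<k} \<longrightarrow> lam i \<in> {..k}) \<and> (i \<notin> {..<k} \<longrightarrow> lam i = 0)}"
    by (rule finite_set_of_finite_funs) auto
qed

section \<open>Counting components, rows and columns of skew shapes\<close>

lemma card_image_eq_if_same_kernel:
  assumes "\<And>p q. p \<in> D \<Longrightarrow> q \<in> D \<Longrightarrow> f p = f q \<longleftrightarrow> h p = h q"
  shows "card (f ` D) = card (h ` D)"
proof -
  have inv: "inv_into D h v \<in> D" "h (inv_into D h v) = v" if "v \<in> h ` D" for v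
    using that by (auto intro: inv_into_into f_inv_into_f)
  have "f ` D = (\<lambda>v. f (inv_into D h v)) ` h ` D"
    using assms inv by (force simp: image_iff)
  moreover have "inj_on (\<lambda>v. f (inv_into D h v)) (h ` D)"
    by (intro inj_onI) (metis assms inv)
  ultimately show ?thesis by (simp add: card_image)
qed

text \<open>Here \<open>h\<close> is a complete invariant of connected components: constant along
  edges, and equal only on connected points.\<close>

lemma card_quotient_rtrancl:
  assumes const: "\<And>p q. (p, q) \<in> R \<Longrightarrow> h p = h q"
    and connected: "\<And>p q. p \<in> D \<Longrightarrow> q \<in> D \<Longrightarrow> h p = h q \<Longrightarrow> (p, q) \<in> R\<^sup>*"
  shows "card (D // R\<^sup>*) = card (h ` D)"
proof -
  have const': "h p = h q" if "(p, q) \<in> R\<^sup>*" for p q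
    using that by induction (auto dest: const)
  have "D // R\<^sup>* = (\<lambda>p. R\<^sup>* `` {p}) ` D" by (auto simp: quotient_def)
  also have "card \<dots> = card (h ` D)"
  proof (rule card_image_eq_if_same_kernel)
    fix p q assume pq: "p \<in> D" "q \<in> D"
    show "R\<^sup>* `` {p} = R\<^sup>* `` {q} \<longleftrightarrow> h p = h q"
    proof
      assume "R\<^sup>* `` {p} = R\<^sup>* `` {q}"
      then show "h p = h q" using const'[of p q] by blast
    next
      assume "h p = h q"
      then have "(p, q) \<in> R\<^sup>*" "(q, p) \<in> R\<^sup>*" using connected pq by auto
      then show "R\<^sup>* `` {p} = R\<^sup>* `` {q}" by (auto intro: rtrancl_trans)
    qed
  qed
  finally show ?thesis .
qed

definition cell_adjacency :: "(nat \<Rightarrow> nat) \<Rightarrow> (nat \<Rightarrow> nat) \<Rightarrow> ((nat \<times> nat) \<times> nat \<times> nat) set" where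
  "cell_adjacency lam mu =
     {(p, q). p \<in> skew_cells lam mu \<and> q \<in> skew_cells lam mu \<and> edge_adjacent p q}"

lemma skew_components_eq:
  "skew_components lam mu = card (skew_cells lam mu // (cell_adjacency lam mu)\<^sup>*)"
  by (simp add: skew_components_def cell_adjacency_def Let_def)

lemma sym_cell_adjacency: "sym (cell_adjacency lam mu)"
  by (auto simp: sym_def cell_adjacency_def edge_adjacent_def)

lemma skew_cells_conjugate:
  assumes "is_partition lam" "is_partition mu"
  shows "skew_cells (conjugate lam) (conjugate mu) = prod.swap ` skew_cells lam mu"
  by (auto simp: skew_cells_def image_iff not_less[symmetric] less_conjugate_iff assms)

lemma skew_rows_conjugate:
  assumes "is_partition lam" "is_partition mu"
  shows "skew_rows (conjugate lam) (conjugate mu) = skew_cols lam mu"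
proof -
  have "{i. conjugate mu i < conjugate lam i} = fst ` skew_cells (conjugate lam) (conjugate mu)"
    by (force simp: skew_cells_def image_iff)
  then show ?thesis
    by (simp add: skew_rows_def skew_cols_def skew_cells_conjugate[OF assms] image_image)
qed

lemma skew_cols_conjugate:
  assumes "is_partition lam" "is_partition mu"
  shows "skew_cols (conjugate lam) (conjugate mu) = skew_rows lam mu"
  using skew_rows_conjugate[of "conjugate lam" "conjugate mu"] assms
  by (simp add: is_partition_conjugate conjugate_conjugate)

lemma skew_components_conjugate:
  assumes "is_partition lam" "is_partition mu"
  shows "skew_components (conjugate lam) (conjugate mu) = skew_components lam mu"
proof -
  let ?R = "cell_adjacency lam mu" and ?R' = "cell_adjacency (conjugate lam) (conjugate mu)"
  \<comment> \<open>The invariant of a transposed cell is the component of the original cell;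
    transposition preserves adjacency.\<close>
  let ?h = "\<lambda>p. ?R\<^sup>* `` {prod.swap p}"
  have R': "(prod.swap p, prod.swap q) \<in> ?R' \<longleftrightarrow> (p, q) \<in> ?R" for p q
  proof -
    have "prod.swap p \<in> skew_cells (conjugate lam) (conjugate mu) \<longleftrightarrow> p \<in> skew_cells lam mu" for p
      unfolding skew_cells_conjugate[OF assms] by (rule inj_image_mem_iff) simp
    moreover have "edge_adjacent (prod.swap p) (prod.swap q) = edge_adjacent p q"
      by (cases p; cases q) (auto simp: edge_adjacent_def)
    ultimately show ?thesis by (simp add: cell_adjacency_def)
  qed
  have path: "(prod.swap p, prod.swap q) \<in> ?R'\<^sup>*" if "(p, q) \<in> ?R\<^sup>*" for p q
    using that
  proof induction
    case (step q r)
    then show ?case using R'[of q r] by (blast intro: rtrancl_into_rtrancl)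
  qed simp
  have sym: "sym (?R\<^sup>*)" by (intro sym_rtrancl sym_cell_adjacency)
  have "card (skew_cells (conjugate lam) (conjugate mu) // ?R'\<^sup>*)
      = card (?h ` skew_cells (conjugate lam) (conjugate mu))"
  proof (rule card_quotient_rtrancl)
    fix p q assume "(p, q) \<in> ?R'"
    then have "(prod.swap p, prod.swap q) \<in> ?R" using R'[of "prod.swap p" "prod.swap q"] by simp
    then have pq: "(prod.swap p, prod.swap q) \<in> ?R\<^sup>*" by (rule r_into_rtrancl)
    with sym have "(prod.swap q, prod.swap p) \<in> ?R\<^sup>*" by (rule symD)
    with pq show "?h p = ?h q" by (auto intro: rtrancl_trans)
  next
    fix p q assume "?h p = ?h q"
    then have "(prod.swap p, prod.swap q) \<in> ?R\<^sup>*" by blast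
    then show "(p, q) \<in> ?R'\<^sup>*" using path by fastforce
  qed
  also have "?h ` skew_cells (conjugate lam) (conjugate mu) = skew_cells lam mu // ?R\<^sup>*"
    by (auto simp: skew_cells_conjugate[OF assms] quotient_def image_image)
  finally show ?thesis by (simp add: skew_components_eq)
qed

text \<open>Each component is counted at its bottom row.\<close>

lemma skew_components_eq_card_rows:
  assumes L: "is_partition L" and M: "is_partition M"
  shows "skew_components L M = card {i. M i < L i \<and> L (Suc i) \<le> M i}"
proof -
  let ?R = "cell_adjacency L M" and ?D = "skew_cells L M"
  \<comment> \<open>For a nonempty row \<open>i\<close>, \<open>e i\<close> is the bottom row of its
    component: the first row from \<open>i\<close> on that does not overlap the next one.\<close>
  define e where "e i = (LEAST k. i \<le> k \<and> L (Suc k) \<le> M k)" for i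
  obtain n where n: "\<And>i. i \<ge> n \<Longrightarrow> L i = 0" using is_partition_eventually_0[OF L] by blast
  have e: "i \<le> e i \<and> L (Suc (e i)) \<le> M (e i)" for i
    unfolding e_def by (rule LeastI[of _ "max i n"]) (simp add: n)
  have e_self: "e i = i" if "L (Suc i) \<le> M i" for i
    unfolding e_def using that by (intro Least_equality) auto
  have e_Suc: "e i = e (Suc i)" if "M i < L (Suc i)" for i
  proof -
    have "i \<le> k \<and> L (Suc k) \<le> M k \<longleftrightarrow> Suc i \<le> k \<and> L (Suc k) \<le> M k" for k
      using that by (cases "k = i") auto
    then show ?thesis by (simp add: e_def)
  qed
  have row: "((i, j), (i, M i)) \<in> ?R\<^sup>*" if "(i, j) \<in> ?D" for i j
  proof -
    have "M i + k < L i \<Longrightarrow> ((i, M i + k), (i, M i)) \<in> ?R\<^sup>*" for k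
    proof (induction k)
      case (Suc k)
      then have "((i, M i + Suc k), (i, M i + k)) \<in> ?R"
        by (auto simp: cell_adjacency_def skew_cells_def edge_adjacent_def)
      moreover have "((i, M i + k), (i, M i)) \<in> ?R\<^sup>*" using Suc by simp
      ultimately show ?case by (rule converse_rtrancl_into_rtrancl)
    qed simp
    from this[of "j - M i"] that show ?thesis by (simp add: skew_cells_def)
  qed
  \<comment> \<open>Walk left to the start of the row, then down while the next row overlaps: the
    cell below the start lies in the shape because \<open>M\<close> is decreasing.\<close>
  have path: "((i, j), (e i, M (e i))) \<in> ?R\<^sup>* \<and> M (e i) < L (e i)" if "(i, j) \<in> ?D" for i j
    using that
  proof (induction "e i - i" arbitrary: i j rule: less_induct)
    case less
    from less.prems have ij: "M i \<le> j" "j < L i" by (auto simp: skew_cells_def)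
    show ?case
    proof (cases "L (Suc i) \<le> M i")
      case True
      with row[OF less.prems] ij e_self show ?thesis by simp
    next
      case False
      have "M (Suc i) \<le> M i" using is_partition_antimono[OF M] by simp
      then have c: "(Suc i, M i) \<in> ?D" using False by (simp add: skew_cells_def)
      then have step: "((i, M i), (Suc i, M i)) \<in> ?R"
        using ij by (auto simp: cell_adjacency_def skew_cells_def edge_adjacent_def)
      have e_eq: "e i = e (Suc i)" using False e_Suc by simp
      have "e (Suc i) - Suc i < e i - i" using e[of "Suc i"] e_eq by linarith
      note IH = less.hyps[OF this c]
      have "((i, j), (e (Suc i), M (e (Suc i)))) \<in> ?R\<^sup>*"
        using row[OF less.prems] converse_rtrancl_into_rtrancl[OF step conjunct1[OF IH]]
        by (rule rtrancl_trans)
      with IH show ?thesis by (simp add: e_eq)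
    qed
  qed
  have "card (?D // ?R\<^sup>*) = card ((\<lambda>p. e (fst p)) ` ?D)"
  proof (rule card_quotient_rtrancl)
    fix p q assume "(p, q) \<in> ?R"
    then show "e (fst p) = e (fst q)"
      by (auto simp: cell_adjacency_def skew_cells_def edge_adjacent_def e_Suc)
  next
    fix p q assume pq: "p \<in> ?D" "q \<in> ?D" "e (fst p) = e (fst q)"
    have "(p, (e (fst p), M (e (fst p)))) \<in> ?R\<^sup>*" "(q, (e (fst q), M (e (fst q)))) \<in> ?R\<^sup>*"
      using path[of "fst p" "snd p"] path[of "fst q" "snd q"] pq by simp_all
    then show "(p, q) \<in> ?R\<^sup>*" using pq(3)
      by (metis rtrancl_trans sym_cell_adjacency sym_rtrancl symD)
  qed
  also have "(\<lambda>p. e (fst p)) ` ?D = {i. M i < L i \<and> L (Suc i) \<le> M i}"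
  proof safe
    fix i j assume "(i, j) \<in> ?D"
    then show "M (e (fst (i, j))) < L (e (fst (i, j)))" using path by simp
    show "L (Suc (e (fst (i, j)))) \<le> M (e (fst (i, j)))" using e by simp
  next
    fix i assume "M i < L i" "L (Suc i) \<le> M i"
    then show "i \<in> (\<lambda>p. e (fst p)) ` ?D"
      by (intro image_eqI[of _ _ "(i, M i)"]) (auto simp: e_self skew_cells_def)
  qed
  finally show ?thesis by (simp add: skew_components_eq)
qed

text \<open>Each column is counted at its lowest cell.\<close>

lemma skew_cols_eq_sum:
  assumes L: "is_partition L" and M: "is_partition M" and n: "\<And>i. i \<ge> n \<Longrightarrow> L i = 0"
  shows "skew_cols L M = (\<Sum>i<n. L i - max (M i) (L (Suc i)))"
proof -
  let ?I = "\<lambda>i. {max (M i) (L (Suc i))..<L i}"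
  have "snd ` skew_cells L M = (\<Union>i<n. ?I i)"
  proof safe
    fix i j assume "(i, j) \<in> skew_cells L M"
    then have ij: "M i \<le> j" "j < L i" by (auto simp: skew_cells_def)
    \<comment> \<open>The lowest row of \<open>L\<close> that meets column \<open>j\<close>; its
      cell there is outside \<open>M\<close>, which only shrinks below row \<open>i\<close>.\<close>
    define k where "k = (GREATEST k. j < L k)"
    have bound: "\<forall>k. j < L k \<longrightarrow> k \<le> n" using n by (metis le_cases not_less_zero)
    have k: "j < L k" "i \<le> k"
      unfolding k_def using ij bound by (auto intro: GreatestI_nat Greatest_le_nat)
    have "\<not> j < L (Suc k)"
      using Greatest_le_nat[of "\<lambda>k. j < L k" "Suc k" n] bound by (auto simp: k_def)
    moreover have "M k \<le> j" using is_partition_antimono[OF M k(2)] ij by simp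
    moreover have "k < n" using k n by (metis not_le not_less_zero)
    ultimately show "snd (i, j) \<in> (\<Union>i<n. ?I i)" using k by auto
  next
    fix i j assume "j \<in> ?I i"
    then show "j \<in> snd ` skew_cells L M" by (force simp: skew_cells_def image_iff)
  qed
  moreover have "?I i \<inter> ?I k = {}" if "i < k" for i k
    using is_partition_antimono[OF L, of "Suc i" k] that by auto
  then have "?I i \<inter> ?I k = {}" if "i \<noteq> k" for i k
    using that by (metis Int_commute linorder_neqE_nat)
  ultimately show ?thesis by (simp add: skew_cols_def card_UN_disjoint)
qed

text \<open>A sequence with \<open>R i = {0}\<close> from \<open>n\<close> on is determined by its
  first \<open>n\<close> entries, so this is distributivity over a finite product of ranges.\<close>

lemma sum_prod_eventually_0:
  fixes F :: "nat \<Rightarrow> nat \<Rightarrow> 'r :: comm_ring_1"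
  assumes R: "\<And>i. i \<ge> n \<Longrightarrow> R i = {0}" and fin: "\<And>i. finite (R i)"
  shows "(\<Sum>L | \<forall>i. L i \<in> R i. \<Prod>i<n. F i (L i)) = (\<Prod>i<n. \<Sum>l\<in>R i. F i l)"
proof -
  have "(\<Prod>i<n. \<Sum>l\<in>R i. F i l) = (\<Sum>g\<in>PiE {..<n} R. \<Prod>i<n. F i (g i))"
    by (rule prod_sum_PiE) (auto simp: fin)
  also have "\<dots> = (\<Sum>L | \<forall>i. L i \<in> R i. \<Prod>i<n. F i (L i))"
    by (rule sum.reindex_bij_witness[where i = "\<lambda>L. restrict L {..<n}"
          and j = "\<lambda>g i. if i < n then g i else 0"])
       (auto simp: fun_eq_iff PiE_def Pi_def extensional_def R not_less
          intro!: prod.cong, (metis R leI singletonD)?)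
  finally show ?thesis by simp
qed

lemma card_eq_sum_of_bool:
  assumes "\<And>i :: nat. i \<ge> n \<Longrightarrow> \<not> P i"
  shows "card {i. P i} = (\<Sum>i<n. of_bool (P i))"
proof -
  have "{i. P i} = {i\<in>{..<n}. P i}" using assms by (auto intro: ccontr)
  then show ?thesis by (simp add: of_bool_def flip: sum.inter_filter)
qed

section \<open>The skew identity\<close>

definition dual_step :: "'b \<Rightarrow> 'b \<Rightarrow> 'b \<Rightarrow> (nat \<Rightarrow> nat) \<Rightarrow> (nat \<Rightarrow> nat) \<Rightarrow> 'b :: comm_ring_1" where
  "dual_step \<alpha> \<beta> y lam mu =
     (let r = skew_rows lam mu; c = skew_cols lam mu; b = skew_components lam mu
      in \<beta> ^ (r - b) * (\<alpha> + \<beta>) ^ ((psize lam + b) - (psize mu + r + c)) * y ^ b * (\<alpha> + y) ^ (c - b))"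

definition grothendieck_step :: "'b \<Rightarrow> 'b \<Rightarrow> (nat \<Rightarrow> nat) \<Rightarrow> (nat \<Rightarrow> nat) \<Rightarrow> 'b :: comm_ring_1" where
  "grothendieck_step t s lam mu =
     t ^ (psize lam - psize mu) * s ^ skew_rows mu (remove_first_row lam)"

lemma dual_g_Suc_eq:
  "dual_g \<alpha> \<beta> y (Suc n) lam =
     (\<Sum>mu | is_partition mu \<and> mu \<le> lam. dual_g \<alpha> \<beta> y n mu * dual_step \<alpha> \<beta> (y (Suc n)) lam mu)"
  by (simp add: dual_step_def Let_def mult.assoc)

text \<open>Conjugation preserves containment, so the recursion can be indexed by the shapes on the
  Grothendieck side.\<close>

lemma dual_g_Suc_conjugate:
  assumes "is_partition L"
  shows "dual_g \<alpha> \<beta> y (Suc n) (conjugate L) =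
     (\<Sum>M | is_partition M \<and> M \<le> L.
        dual_g \<alpha> \<beta> y n (conjugate M) * dual_step \<alpha> \<beta> (y (Suc n)) (conjugate L) (conjugate M))"
  unfolding dual_g_Suc_eq
proof (rule sum.reindex_bij_witness[where i = conjugate and j = conjugate])
  fix mu assume "mu \<in> {mu. is_partition mu \<and> mu \<le> conjugate L}"
  then have mu: "is_partition mu" "mu \<le> conjugate L" by auto
  then show "conjugate (conjugate mu) = mu" by (simp add: conjugate_conjugate)
  show "conjugate mu \<in> {M. is_partition M \<and> M \<le> L}"
    using mu assms conjugate_le_iff[of "conjugate L" mu]
    by (simp add: is_partition_conjugate conjugate_conjugate)
  show "dual_g \<alpha> \<beta> y n (conjugate (conjugate mu)) *
      dual_step \<alpha> \<beta> (y (Suc n)) (conjugate L) (conjugate (conjugate mu)) =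
      dual_g \<alpha> \<beta> y n mu * dual_step \<alpha> \<beta> (y (Suc n)) (conjugate L) mu"
    using mu by (simp add: conjugate_conjugate)
qed (use assms in \<open>auto simp: conjugate_conjugate is_partition_conjugate conjugate_le_iff\<close>)

lemma horizontal_strip_le: "horizontal_strip L N \<Longrightarrow> N \<le> L"
  by (simp add: horizontal_strip_def le_fun_def)

lemma grothendieck_step_eq_prod:
  assumes "horizontal_strip L N" and n: "\<And>i. i \<ge> n \<Longrightarrow> L i = 0"
  shows "grothendieck_step t s L N
    = (\<Prod>i<n. t ^ (L i - N i) * (if L (Suc i) < N i then s else 1))"
proof -
  have le: "N i \<le> L i" for i using assms(1) by (simp add: horizontal_strip_def)
  have n': "N i = 0" if "i \<ge> n" for i using le[of i] n[OF that] by simp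
  have "psize L - psize N = (\<Sum>i<n. L i - N i)"
    using le by (simp add: psize_eq_sum[OF n] psize_eq_sum[OF n'] sum_subtractf_nat)
  moreover have "skew_rows N (remove_first_row L) = (\<Sum>i<n. of_bool (L (Suc i) < N i))"
    unfolding skew_rows_def remove_first_row_def by (rule card_eq_sum_of_bool) (simp add: n')
  moreover have "s ^ of_bool P = (if P then s else 1)" for P by simp
  ultimately show ?thesis
    by (simp only: grothendieck_step_def power_sum prod.distrib)
qed

text \<open>The quotients \<open>g (Suc i) / g i\<close> telescope; the cross-multiplied form does
  not require \<open>g\<close> to be invertible.\<close>

lemma prod_telescope_exchange:
  fixes f g h :: "nat \<Rightarrow> 'r :: comm_ring_1"
  assumes "\<And>i. f i * g i = h i * g (Suc i)"
  shows "(\<Prod>i<n. f i) * g 0 = (\<Prod>i<n. h i) * g n"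
proof (induction n)
  case (Suc n)
  have "(\<Prod>i<Suc n. f i) * g 0 = ((\<Prod>i<n. f i) * g 0) * f n" by (simp add: ac_simps)
  also have "\<dots> = (\<Prod>i<n. h i) * (f n * g n)" unfolding Suc by (simp only: ac_simps)
  also have "\<dots> = (\<Prod>i<Suc n. h i) * g (Suc n)" by (simp add: assms ac_simps)
  finally show ?case .
qed simp

context cauchy_parameters
begin

text \<open>All statistics of the skew shape are sums over rows of \<open>L\<close>, so every
  exponent splits row by row. Conjugation exchanges row and column counts.\<close>

lemma dual_step_conjugate:
  assumes L: "is_partition L" and M: "is_partition M" and le: "M \<le> L"
    and n: "\<And>i. i \<ge> n \<Longrightarrow> L i = 0"
  shows "dual_step \<alpha> \<beta> y (conjugate L) (conjugate M)
    = (\<Prod>i<n. lower_weight (L i) (L (Suc i)) (M i))"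
proof -
  have le': "M i \<le> L i" for i using le by (simp add: le_fun_def)
  have n': "M i = 0" if "i \<ge> n" for i using le'[of i] n[OF that] by simp
  have dec: "L (Suc i) \<le> L i" for i by (rule is_partition_antimono[OF L]) simp
  \<comment> \<open>Row \<open>i\<close> contributes \<open>b i\<close> if a component ends there,
    \<open>r i\<close> if it is nonempty, and \<open>c i\<close> for the columns whose lowest cell
    it contains.\<close>
  define b where "b i = (of_bool (M i < L i \<and> L (Suc i) \<le> M i) :: nat)" for i
  define r where "r i = (of_bool (M i < L i) :: nat)" for i
  define c where "c i = L i - max (M i) (L (Suc i))" for i
  have B: "skew_components (conjugate L) (conjugate M) = (\<Sum>i<n. b i)"
    unfolding b_def skew_components_conjugate[OF L M] skew_components_eq_card_rows[OF L M]
    by (rule card_eq_sum_of_bool) (simp add: n)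
  have C: "skew_cols (conjugate L) (conjugate M) = (\<Sum>i<n. r i)"
    unfolding r_def skew_cols_conjugate[OF L M] skew_rows_def
    by (rule card_eq_sum_of_bool) (simp add: n)
  have R: "skew_rows (conjugate L) (conjugate M) = (\<Sum>i<n. c i)"
    unfolding c_def skew_rows_conjugate[OF L M] by (rule skew_cols_eq_sum[OF L M n])
  have P: "psize (conjugate L) = (\<Sum>i<n. L i)" "psize (conjugate M) = (\<Sum>i<n. M i)"
    by (simp_all add: psize_conjugate L M psize_eq_sum[OF n] psize_eq_sum[OF n'])
  \<comment> \<open>These bounds let the truncated subtractions in the exponents commute with
    summation over rows.\<close>
  have bc: "b i \<le> c i" and br: "b i \<le> r i" and lm: "M i + c i + r i \<le> L i + b i" for i
    using dec[of i] le'[of i] by (auto simp: b_def r_def c_def)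
  have w: "\<beta> ^ (c i - b i) * (\<alpha> + \<beta>) ^ ((L i + b i) - (M i + c i + r i)) * y ^ b i * (\<alpha> + y) ^ (r i - b i)
      = lower_weight (L i) (L (Suc i)) (M i)" for i
  proof -
    \<comment> \<open>The row is empty, ends a component, or overlaps the next row: the branches of
      \<open>lower_weight\<close>.\<close>
    consider "M i = L i" | "M i < L i" "L (Suc i) \<le> M i" | "M i < L (Suc i)"
      using le'[of i] by linarith
    then show ?thesis
    proof cases
      case 1
      then show ?thesis using dec[of i] by (simp add: b_def r_def c_def lower_weight_def)
    next
      case 2
      then show ?thesis by (simp add: b_def r_def c_def lower_weight_def max_def)
    next
      case 3
      then have "L i - (M i + (L i - L (Suc i)) + 1) = L (Suc i) - M i - 1"
        using dec[of i] by simp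
      with 3 show ?thesis
        using dec[of i] by (simp add: b_def r_def c_def lower_weight_def max_def)
    qed
  qed
  have "(\<Sum>i<n. c i) - (\<Sum>i<n. b i) = (\<Sum>i<n. c i - b i)"
    "(\<Sum>i<n. r i) - (\<Sum>i<n. b i) = (\<Sum>i<n. r i - b i)"
    using bc br by (simp_all add: sum_subtractf_nat)
  moreover have "((\<Sum>i<n. L i) + (\<Sum>i<n. b i)) - ((\<Sum>i<n. M i) + (\<Sum>i<n. c i) + (\<Sum>i<n. r i))
     = (\<Sum>i<n. (L i + b i) - (M i + c i + r i))"
    using lm by (simp only: sum.distrib[symmetric] sum_subtractf_nat)
  ultimately show ?thesis
    unfolding dual_step_def Let_def B C R P by (simp only: power_sum prod.distrib[symmetric] w)
qed

text \<open>Telescoping \<open>lower_upper_exchange\<close> hands every overlap to the lower of two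
  adjacent rows. Each factor on the right then contains a single row of \<open>L\<close>, as
  summation over \<open>L\<close> requires.\<close>

lemma prod_lower_eq_prod_upper:
  assumes L: "is_partition L" and M: "is_partition M" and le: "M \<le> L"
  shows "(\<Prod>i<n. lower_weight (L i) (L (Suc i)) (M i)) * row_weight (L n) (M n)
     = row_weight (L 0) (M 0) * (\<Prod>i<n. upper_weight (M (Suc i)) (M i) (L (Suc i)))"
proof -
  have "upper_weight (M (Suc i)) (M i) (L (Suc i)) * row_weight (L i) (M i)
      = lower_weight (L i) (L (Suc i)) (M i) * row_weight (L (Suc i)) (M (Suc i))" for i
    using lower_upper_exchange[of "M (Suc i)" "M i" "L i" "L (Suc i)"] le
      is_partition_antimono[OF L, of i "Suc i"] is_partition_antimono[OF M, of i "Suc i"]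
    by (simp add: le_fun_def mult.commute)
  from prod_telescope_exchange[where g = "\<lambda>i. row_weight (L i) (M i)", OF this, of n]
  show ?thesis by (simp add: mult.commute)
qed

text \<open>Interlacing with \<open>N\<close> and containment of \<open>M\<close> confine each row
  of \<open>L\<close> after the first to an interval depending on \<open>M\<close> and
  \<open>N\<close> only, so the sum factors. \<open>T\<close> makes the range of the first row
  finite.\<close>

lemma sum_added_strips:
  assumes M: "is_partition M" and N: "is_partition N"
    and n: "\<And>i. i \<ge> n \<Longrightarrow> M i = 0" "\<And>i. i \<ge> n \<Longrightarrow> N i = 0"
  shows "(\<Sum>L | is_partition L \<and> horizontal_strip L N \<and> M \<le> L \<and> L 0 \<le> T.
       grothendieck_step t s L N * dual_step \<alpha> \<beta> y (conjugate L) (conjugate M))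
     = (\<Sum>l=max (M 0) (N 0)..T. row_weight l (M 0) * t ^ (l - N 0))
       * (\<Prod>i<n. upper_sum (M (Suc i)) (M i) (N (Suc i)) (N i))"
proof -
  define R where "R i = (case i of 0 \<Rightarrow> {max (M 0) (N 0)..T}
    | Suc j \<Rightarrow> {max (M (Suc j)) (N (Suc j))..N j})" for i
  define F where "F i l = (case i of 0 \<Rightarrow> row_weight l (M 0) * t ^ (l - N 0)
    | Suc j \<Rightarrow> upper_weight (M (Suc j)) (M j) l * t ^ (l - N (Suc j)) * (if l < N j then s else 1))"
    for i l
  \<comment> \<open>\<open>L\<close> may have one row more than \<open>M\<close> and
    \<open>N\<close>, hence \<open>Suc n\<close>.\<close>
  have R0: "R i = {0}" if "i \<ge> Suc n" for i
    using that n by (cases i) (auto simp: R_def)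
  have L0: "L i = 0" if "\<forall>i. L i \<in> R i" "i \<ge> Suc n" for L i
    using that R0[of i] by (metis singletonD)
  have set_eq: "{L. is_partition L \<and> horizontal_strip L N \<and> M \<le> L \<and> L 0 \<le> T}
      = {L. \<forall>i. L i \<in> R i}" (is "?A = ?B")
  proof (intro set_eqI iffI)
    fix L assume "L \<in> ?A"
    then show "L \<in> ?B"
      by (auto simp: R_def horizontal_strip_def le_fun_def split: nat.split)
  next
    fix L assume L: "L \<in> ?B"
    have R: "L 0 \<in> R 0" "L (Suc i) \<in> R (Suc i)" for i using L by auto
    have M_le: "M i \<le> L i" and N_le: "N i \<le> L i" for i
      using R by (cases i; simp add: R_def)+
    have le_N: "L (Suc i) \<le> N i" for i using R(2)[of i] by (simp add: R_def)
    have "is_partition L"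
      by (rule is_partitionI[of L "Suc n"]) (use L0 L le_N N_le order_trans in blast)+
    then show "L \<in> ?A"
      using R(1) M_le N_le le_N by (simp add: horizontal_strip_def le_fun_def R_def)
  qed
  have term_eq: "grothendieck_step t s L N * dual_step \<alpha> \<beta> y (conjugate L) (conjugate M)
      = (\<Prod>i<Suc n. F i (L i))" if "L \<in> {L. \<forall>i. L i \<in> R i}" for L
  proof -
    from that have L: "is_partition L" "horizontal_strip L N" "M \<le> L" "\<forall>i. L i \<in> R i"
      unfolding set_eq[symmetric] using that by auto
    \<comment> \<open>Nothing lies below row \<open>n\<close>, so its lower weight is the boundary
      factor in \<open>prod_lower_eq_prod_upper\<close>.\<close>
    have "L (Suc n) = 0" using L0 L(4) by simp
    then have "lower_weight (L n) (L (Suc n)) (M n) = row_weight (L n) (M n)"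
      using n by (simp add: lower_weight_def row_weight_def)
    then have "dual_step \<alpha> \<beta> y (conjugate L) (conjugate M)
        = row_weight (L 0) (M 0) * (\<Prod>i<n. upper_weight (M (Suc i)) (M i) (L (Suc i)))"
      using dual_step_conjugate[OF L(1) M L(3), of "Suc n"] L0[OF L(4)]
        prod_lower_eq_prod_upper[OF L(1) M L(3)]
      by simp
    moreover have "grothendieck_step t s L N = t ^ (L 0 - N 0) *
        (\<Prod>i<n. t ^ (L (Suc i) - N (Suc i)) * (if L (Suc i) < N i then s else 1))"
    proof -
      have "grothendieck_step t s L N
        = (\<Prod>i<Suc n. t ^ (L i - N i)) * (\<Prod>i<Suc n. if L (Suc i) < N i then s else 1)"
        unfolding prod.distrib[symmetric]
        by (rule grothendieck_step_eq_prod[OF L(2) L0[OF L(4)]])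
      also have "(\<Prod>i<Suc n. if L (Suc i) < N i then s else 1)
        = (\<Prod>i<n. if L (Suc i) < N i then s else 1)" using n by simp
      also have "(\<Prod>i<Suc n. t ^ (L i - N i))
        = t ^ (L 0 - N 0) * (\<Prod>i<n. t ^ (L (Suc i) - N (Suc i)))"
        by (rule prod.lessThan_Suc_shift)
      finally show ?thesis by (simp only: prod.distrib mult.assoc)
    qed
    moreover have "(\<Prod>i<Suc n. F i (L i)) = (row_weight (L 0) (M 0) * t ^ (L 0 - N 0)) *
       (\<Prod>i<n. upper_weight (M (Suc i)) (M i) (L (Suc i)) * (t ^ (L (Suc i) - N (Suc i))
         * (if L (Suc i) < N i then s else 1)))"
      unfolding prod.lessThan_Suc_shift by (simp add: F_def mult.assoc)
    ultimately show ?thesis by (simp only: prod.distrib ac_simps)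
  qed
  have fin: "finite (R i)" for i by (cases i) (simp_all add: R_def)
  have "(\<Sum>L | is_partition L \<and> horizontal_strip L N \<and> M \<le> L \<and> L 0 \<le> T.
       grothendieck_step t s L N * dual_step \<alpha> \<beta> y (conjugate L) (conjugate M))
     = (\<Sum>L | \<forall>i. L i \<in> R i. \<Prod>i<Suc n. F i (L i))"
    unfolding set_eq by (rule sum.cong[OF refl term_eq])
  also have "\<dots> = (\<Prod>i<Suc n. \<Sum>l\<in>R i. F i l)"
    by (rule sum_prod_eventually_0[OF R0 fin])
  also have "\<dots> = (\<Sum>l\<in>R 0. F 0 l) * (\<Prod>i<n. \<Sum>l\<in>R (Suc i). F (Suc i) l)"
    by (rule prod.lessThan_Suc_shift)
  finally show ?thesis by (simp add: R_def F_def upper_sum_def)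
qed

text \<open>With \<open>K\<close> as the inner shape it is \<open>lower_weight\<close> that isolates
  a single row of \<open>K\<close>; every row is bounded, so no truncation occurs.\<close>

lemma sum_removed_strips:
  assumes M: "is_partition M" and N: "is_partition N"
    and n: "\<And>i. i \<ge> n \<Longrightarrow> M i = 0" "\<And>i. i \<ge> n \<Longrightarrow> N i = 0"
  shows "(\<Sum>K | is_partition K \<and> horizontal_strip M K \<and> K \<le> N.
       grothendieck_step t s M K * dual_step \<alpha> \<beta> y (conjugate N) (conjugate K))
     = (\<Prod>i<n. lower_sum (M (Suc i)) (M i) (N (Suc i)) (N i))"
proof -
  define R where "R i = {M (Suc i)..min (M i) (N i)}" for i
  define F where "F i k = lower_weight (N i) (N (Suc i)) k * t ^ (M i - k) *
    (if M (Suc i) < k then s else 1)" for i k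
  have R0: "R i = {0}" if "i \<ge> n" for i using that n by (simp add: R_def)
  have set_eq: "{K. is_partition K \<and> horizontal_strip M K \<and> K \<le> N} = {K. \<forall>i. K i \<in> R i}"
    (is "?A = ?B")
  proof (intro set_eqI iffI)
    fix K assume "K \<in> ?A"
    then show "K \<in> ?B" by (auto simp: R_def horizontal_strip_def le_fun_def)
  next
    fix K assume K: "K \<in> ?B"
    then have KR: "M (Suc i) \<le> K i" "K i \<le> M i" "K i \<le> N i" for i by (auto simp: R_def)
    have "is_partition K"
    proof (rule is_partitionI)
      show "K (Suc i) \<le> K i" for i using KR(2)[of "Suc i"] KR(1)[of i] by simp
      show "K i = 0" if "i \<ge> n" for i using KR(2)[of i] n(1)[OF that] by simp
    qed
    then show "K \<in> ?A" using KR by (simp add: horizontal_strip_def le_fun_def)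
  qed
  have term_eq: "grothendieck_step t s M K * dual_step \<alpha> \<beta> y (conjugate N) (conjugate K)
      = (\<Prod>i<n. F i (K i))" if "K \<in> {K. \<forall>i. K i \<in> R i}" for K
  proof -
    from that have K: "is_partition K" "horizontal_strip M K" "K \<le> N"
      unfolding set_eq[symmetric] by auto
    have "grothendieck_step t s M K = (\<Prod>i<n. t ^ (M i - K i) * (if M (Suc i) < K i then s else 1))"
      by (rule grothendieck_step_eq_prod[OF K(2) n(1)])
    moreover have "dual_step \<alpha> \<beta> y (conjugate N) (conjugate K)
        = (\<Prod>i<n. lower_weight (N i) (N (Suc i)) (K i))"
      by (rule dual_step_conjugate[OF N K(1) K(3) n(2)])
    ultimately show ?thesis by (simp only: F_def prod.distrib ac_simps)
  qed
  have "(\<Sum>K | is_partition K \<and> horizontal_strip M K \<and> K \<le> N.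
       grothendieck_step t s M K * dual_step \<alpha> \<beta> y (conjugate N) (conjugate K))
     = (\<Sum>K | \<forall>i. K i \<in> R i. \<Prod>i<n. F i (K i))"
    unfolding set_eq by (rule sum.cong[OF refl term_eq])
  also have "\<dots> = (\<Prod>i<n. \<Sum>k\<in>R i. F i k)"
    by (rule sum_prod_eventually_0[OF R0]) (simp_all add: R_def)
  finally show ?thesis by (simp add: R_def F_def lower_sum_def)
qed

lemma skew_cauchy_truncated:
  assumes M: "is_partition M" and N: "is_partition N" and T: "M 0 \<le> T" "N 0 \<le> T"
  shows "t ^ (T + 1 - N 0) dvd
    (\<Sum>L | is_partition L \<and> horizontal_strip L N \<and> M \<le> L \<and> L 0 \<le> T.
       grothendieck_step t s L N * dual_step \<alpha> \<beta> y (conjugate L) (conjugate M))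
    - (1 + x * y) * (\<Sum>K | is_partition K \<and> horizontal_strip M K \<and> K \<le> N.
       grothendieck_step t s M K * dual_step \<alpha> \<beta> y (conjugate N) (conjugate K))"
proof -
  obtain n1 n2 where n1: "\<And>i. i \<ge> n1 \<Longrightarrow> M i = 0" and n2: "\<And>i. i \<ge> n2 \<Longrightarrow> N i = 0"
    using is_partition_eventually_0[OF M] is_partition_eventually_0[OF N] by metis
  define n where "n = max n1 n2"
  have n: "\<And>i. i \<ge> n \<Longrightarrow> M i = 0" "\<And>i. i \<ge> n \<Longrightarrow> N i = 0"
    using n1 n2 by (simp_all add: n_def)
  let ?U = "\<Prod>i<n. upper_sum (M (Suc i)) (M i) (N (Suc i)) (N i)"
  let ?D = "\<Prod>i<n. lower_sum (M (Suc i)) (M i) (N (Suc i)) (N i)"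
  let ?S = "\<Sum>l=max (M 0) (N 0)..T. row_weight l (M 0) * t ^ (l - N 0)"
  have "upper_sum (M (Suc i)) (M i) (N (Suc i)) (N i) * gauge (M i) (N i)
      = lower_sum (M (Suc i)) (M i) (N (Suc i)) (N i) * gauge (M (Suc i)) (N (Suc i))" for i
    by (intro row_exchange is_partition_antimono[OF M] is_partition_antimono[OF N]) simp_all
  \<comment> \<open>Both lengths are zero at row \<open>n\<close> and \<open>gauge 0 0 = 1\<close>,
    so only the gauge of the first row survives, the one that \<open>first_row_sum\<close>
    produces.\<close>
  from prod_telescope_exchange[where g = "\<lambda>i. gauge (M i) (N i)", OF this, of n]
  have "?D = gauge (M 0) (N 0) * ?U" using n by (simp add: gauge_def mult.commute)
  then have "?S * ?U - (1 + x * y) * ?D = (?S - (1 + x * y) * gauge (M 0) (N 0)) * ?U"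
    by (simp only: left_diff_distrib mult.assoc)
  then have "t ^ (T + 1 - N 0) dvd ?S * ?U - (1 + x * y) * ?D"
    using first_row_sum[OF T] by simp
  moreover have "(\<Sum>L | is_partition L \<and> horizontal_strip L N \<and> M \<le> L \<and> L 0 \<le> T.
       grothendieck_step t s L N * dual_step \<alpha> \<beta> y (conjugate L) (conjugate M)) = ?S * ?U"
    by (rule sum_added_strips[OF M N n])
  moreover have "(\<Sum>K | is_partition K \<and> horizontal_strip M K \<and> K \<le> N.
       grothendieck_step t s M K * dual_step \<alpha> \<beta> y (conjugate N) (conjugate K)) = ?D"
    by (rule sum_removed_strips[OF M N n])
  ultimately show ?thesis by (simp only:)
qed

end

section \<open>Power series modulo high degree\<close>

text \<open>The degree filtration, each variable having degree one; congruence modulo its steps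
  replaces limits.\<close>

definition vanishes_below :: "nat \<Rightarrow> ('v, 'a :: comm_ring_1) mfps \<Rightarrow> bool" where
  "vanishes_below k f \<longleftrightarrow> (\<forall>M. size M < k \<longrightarrow> mcoeff f M = 0)"

lemma vanishes_below_0 [simp]: "vanishes_below 0 f"
  and vanishes_below_zero [simp]: "vanishes_below k 0"
  by (simp_all add: vanishes_below_def zero_mfps.rep_eq)

lemma vanishes_below_mono: "vanishes_below k f \<Longrightarrow> j \<le> k \<Longrightarrow> vanishes_below j f"
  by (simp add: vanishes_below_def)

lemma vanishes_below_add: "vanishes_below k f \<Longrightarrow> vanishes_below k g \<Longrightarrow> vanishes_below k (f + g)"
  and vanishes_below_uminus: "vanishes_below k f \<Longrightarrow> vanishes_below k (- f)"
  by (simp_all add: vanishes_below_def plus_mfps.rep_eq uminus_mfps.rep_eq)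

lemma vanishes_below_trans:
  "vanishes_below k (f - g) \<Longrightarrow> vanishes_below k (g - h) \<Longrightarrow> vanishes_below k (f - h)"
  by (simp add: vanishes_below_def minus_mfps.rep_eq)

lemma vanishes_below_sum:
  "(\<And>a. a \<in> A \<Longrightarrow> vanishes_below k (f a)) \<Longrightarrow> vanishes_below k (\<Sum>a\<in>A. f a)"
  by (induction A rule: infinite_finite_induct) (auto intro: vanishes_below_add)

lemma vanishes_below_mult:
  assumes "vanishes_below j f" "vanishes_below k g"
  shows "vanishes_below (j + k) (f * g)"
  unfolding vanishes_below_def
proof (intro allI impI)
  fix M :: "'a multiset" assume M: "size M < j + k"
  have "mcoeff f N * mcoeff g (M - N) = 0" if "N \<subseteq># M" for N
  proof -
    have "size N < j \<or> size (M - N) < k" using M size_mset_mono[OF that] by (simp add: size_Diff_submset[OF that]) linarith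
    then show ?thesis using assms by (auto simp: vanishes_below_def)
  qed
  then show "mcoeff (f * g) M = 0" by (simp add: times_mfps.rep_eq)
qed

lemma vanishes_below_mult_left: "vanishes_below k g \<Longrightarrow> vanishes_below k (f * g)"
  using vanishes_below_mult[of 0 f k g] by simp

lemma vanishes_below_mult_right: "vanishes_below k f \<Longrightarrow> vanishes_below k (f * g)"
  using vanishes_below_mult_left[of k f g] by (simp add: mult.commute)

lemma vanishes_below_dvd: "f dvd g \<Longrightarrow> vanishes_below k f \<Longrightarrow> vanishes_below k g"
  by (auto elim!: dvdE intro: vanishes_below_mult_right)

lemma vanishes_below_power: "vanishes_below 1 f \<Longrightarrow> vanishes_below k (f ^ k)"
proof (induction k)
  case (Suc k)
  then show ?case using vanishes_below_mult[of 1 f k "f ^ k"] by simp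
qed simp

lemma mcoeff_sum: "mcoeff (\<Sum>a\<in>A. f a) M = (\<Sum>a\<in>A. mcoeff (f a) M)"
  by (induction A rule: infinite_finite_induct) (simp_all add: zero_mfps.rep_eq plus_mfps.rep_eq)

text \<open>The inverse is the geometric series of \<open>h\<close>. Its coefficient at
  \<open>M\<close> may be cut at \<open>size M\<close>, since \<open>h ^ i\<close> vanishes below
  degree \<open>i\<close>.\<close>

lemma mfps_one_minus_unit:
  assumes "vanishes_below 1 h"
  shows "(1 - h) dvd 1"
proof -
  define g where "g = Abs_mfps (\<lambda>M. \<Sum>i\<le>size M. mcoeff (h ^ i) M)"
  have g: "mcoeff g M = (\<Sum>i\<le>size M. mcoeff (h ^ i) M)" for M
    by (simp add: g_def Abs_mfps_inverse)
  have approx: "vanishes_below (Suc k) (g - (\<Sum>i\<le>k. h ^ i))" for k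
    unfolding vanishes_below_def
  proof (intro allI impI)
    fix M :: "'a multiset" assume M: "size M < Suc k"
    have "(\<Sum>i\<le>k. mcoeff (h ^ i) M) = (\<Sum>i\<le>size M. mcoeff (h ^ i) M)"
      using M vanishes_below_power[OF assms]
      by (intro sum.mono_neutral_right) (auto simp: vanishes_below_def)
    then show "mcoeff (g - (\<Sum>i\<le>k. h ^ i)) M = 0" by (simp add: minus_mfps.rep_eq mcoeff_sum g)
  qed
  have "(1 - h) * g = 1"
  proof (rule mfps_eqI)
    fix M :: "'a multiset"
    define k where "k = size M"
    have "(1 - h) * (\<Sum>i\<le>k. h ^ i) = 1 - h ^ Suc k"
      by (induction k) (simp_all add: distrib_left left_diff_distrib)
    then have "(1 - h) * g - 1 = (1 - h) * (g - (\<Sum>i\<le>k. h ^ i)) + - (h ^ Suc k)"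
      by (simp add: right_diff_distrib)
    moreover have "vanishes_below (Suc k) ((1 - h) * (g - (\<Sum>i\<le>k. h ^ i)) + - (h ^ Suc k))"
      by (intro vanishes_below_add vanishes_below_uminus vanishes_below_mult_left approx
          vanishes_below_power assms)
    ultimately have "vanishes_below (Suc k) ((1 - h) * g - 1)" by (simp only:)
    then show "mcoeff ((1 - h) * g) M = mcoeff 1 M"
      by (simp add: vanishes_below_def minus_mfps.rep_eq k_def)
  qed
  then show ?thesis by (metis dvdI)
qed

text \<open>A neighbourhood of \<open>S\<close> contains every series sharing finitely many
  coefficients with it. Once \<open>k\<close> exceeds their degrees, terms outside
  \<open>Q k\<close> do not affect them.\<close>

lemma has_sum_mfpsI:
  fixes f :: "'i \<Rightarrow> ('v, 'a :: comm_ring_1) mfps"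
  assumes "\<And>k. finite (Q k)" "\<And>k. Q k \<subseteq> A"
    and tail: "\<And>k a. a \<in> A - Q k \<Longrightarrow> vanishes_below k (f a)"
    and approx: "\<And>k. vanishes_below k ((\<Sum>a\<in>Q k. f a) - S)"
  shows "(f has_sum S) A"
  unfolding has_sum_def
proof (rule topological_tendstoI)
  fix U :: "('v, 'a) mfps set" assume "open U" "S \<in> U"
  then obtain B where B: "finite B" "\<And>g. \<forall>M\<in>B. mcoeff g M = mcoeff S M \<Longrightarrow> g \<in> U"
    unfolding open_mfps_def by blast
  define k where "k = Suc (\<Sum>M\<in>B. size M)"
  have size: "size M < k" if "M \<in> B" for M
    using member_le_sum[of M B size] that B(1) by (simp add: k_def)
  show "\<forall>\<^sub>F F in finite_subsets_at_top A. sum f F \<in> U"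
    unfolding eventually_finite_subsets_at_top
  proof (intro exI[of _ "Q k"] conjI allI impI)
    fix F assume F: "finite F \<and> Q k \<subseteq> F \<and> F \<subseteq> A"
    then have "sum f F - S = (sum f (Q k) - S) + sum f (F - Q k)"
      by (simp add: sum.subset_diff[of "Q k" F])
    moreover have "vanishes_below k \<dots>"
      using F by (intro vanishes_below_add approx vanishes_below_sum tail) auto
    ultimately have "vanishes_below k (sum f F - S)" by (simp only:)
    then have "\<forall>M\<in>B. mcoeff (sum f F) M = mcoeff S M"
      using size by (auto simp: vanishes_below_def minus_mfps.rep_eq)
    then show "sum f F \<in> U" by (rule B(2))
  qed (use assms in auto)
qed

section \<open>The Cauchy identity\<close>

definition strip_ratio :: "('v, 'a :: comm_ring_1) mfps \<Rightarrow> ('v, 'a) mfps \<Rightarrow> ('v, 'a) mfps" where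
  "strip_ratio \<beta> x = x / (1 + \<beta> * x)"

section \<open>Passing to power series and induction on both numbers of variables\<close>

context
  fixes \<alpha> \<beta> :: "('v, 'a :: comm_ring_1) mfps"
begin

lemma one_plus_unit: "vanishes_below 1 x \<Longrightarrow> (1 + \<beta> * x) dvd 1"
  using mfps_one_minus_unit[of "- (\<beta> * x)"]
  by (simp add: vanishes_below_mult_left vanishes_below_uminus)

lemma strip_ratio_eq:
  assumes "vanishes_below 1 x"
  shows "strip_ratio \<beta> x * (1 + \<beta> * x) = x"
proof -
  have "x * ((1 + \<beta> * x) * inverse (1 + \<beta> * x)) = x"
    by (simp add: mfps_right_inverse[OF one_plus_unit[OF assms]])
  then show ?thesis by (simp only: strip_ratio_def divide_mfps_def ac_simps)
qed

lemma vanishes_below_strip_ratio: "vanishes_below 1 x \<Longrightarrow> vanishes_below 1 (strip_ratio \<beta> x)"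
  unfolding strip_ratio_def divide_mfps_def by (rule vanishes_below_mult_right)

text \<open>Identifies the row factor for parameters \<open>- \<beta>\<close>,
  \<open>- \<alpha>\<close> with \<open>s\<close>.\<close>

lemma row_ratio_eq:
  assumes "vanishes_below 1 x"
  shows "(1 - \<alpha> * x) / (1 + \<beta> * x) = 1 - (\<alpha> + \<beta>) * strip_ratio \<beta> x"
proof -
  have "1 - \<alpha> * x = (1 + \<beta> * x) - (\<alpha> + \<beta>) * x" by (simp add: algebra_simps)
  then have "(1 - \<alpha> * x) / (1 + \<beta> * x)
      = (1 + \<beta> * x) * inverse (1 + \<beta> * x) - (\<alpha> + \<beta>) * (x * inverse (1 + \<beta> * x))"
    by (simp only: divide_mfps_def left_diff_distrib mult.assoc)
  then show ?thesis
    by (simp only: mfps_right_inverse[OF one_plus_unit[OF assms]] strip_ratio_def divide_mfps_def)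
qed

abbreviation strip_step ::
  "('v, 'a) mfps \<Rightarrow> (nat \<Rightarrow> nat) \<Rightarrow> (nat \<Rightarrow> nat) \<Rightarrow> ('v, 'a) mfps" where
  "strip_step x \<equiv> grothendieck_step (strip_ratio \<beta> x) (1 - (\<alpha> + \<beta>) * strip_ratio \<beta> x)"

lemma canonical_G_Suc_eq:
  assumes "vanishes_below 1 (x (Suc m))"
  shows "canonical_G (- \<beta>) (- \<alpha>) x (Suc m) L =
    (\<Sum>N | is_partition N \<and> horizontal_strip L N.
       canonical_G (- \<beta>) (- \<alpha>) x m N * strip_step (x (Suc m)) L N)"
  using row_ratio_eq[OF assms]
  by (simp add: grothendieck_step_def strip_ratio_def mult.assoc)

lemma vanishes_below_strip_step:
  assumes "vanishes_below 1 x"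
  shows "vanishes_below (psize L - psize N) (strip_step x L N)"
  unfolding grothendieck_step_def
  by (intro vanishes_below_mult_right vanishes_below_power vanishes_below_strip_ratio assms)

text \<open>Each added cell brings a factor of positive order; this is what makes the sum over all
  partitions converge.\<close>

lemma vanishes_below_canonical_G:
  assumes "\<And>i. vanishes_below 1 (x i)" and "is_partition L"
  shows "vanishes_below (psize L) (canonical_G (- \<beta>) (- \<alpha>) x m L)"
  using assms(2)
proof (induction m arbitrary: L)
  case 0
  then show ?case by simp
next
  case (Suc m)
  show ?case unfolding canonical_G_Suc_eq[OF assms(1)]
  proof (rule vanishes_below_sum, clarify)
    fix N assume N: "is_partition N" "horizontal_strip L N"
    have "psize N + (psize L - psize N) = psize L"
      using psize_mono[OF Suc.prems horizontal_strip_le[OF N(2)]] by simp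
    then show "vanishes_below (psize L) (canonical_G (- \<beta>) (- \<alpha>) x m N * strip_step (x (Suc m)) L N)"
      using vanishes_below_mult[OF Suc.IH[OF N(1)] vanishes_below_strip_step[OF assms(1)]] by metis
  qed
qed

lemma canonical_G_empty:
  assumes "\<And>i. vanishes_below 1 (x i)"
  shows "canonical_G (- \<beta>) (- \<alpha>) x m empty_partition = 1"
proof (induction m)
  case (Suc m)
  have "{N. is_partition N \<and> horizontal_strip empty_partition N} = {empty_partition}"
    by (auto simp: horizontal_strip_def empty_partition_def fun_eq_iff is_partition_def)
  then show ?case using Suc
    by (simp only: canonical_G_Suc_eq[OF assms])
       (simp add: grothendieck_step_def skew_rows_def remove_first_row_def empty_partition_def)
qed simp

text \<open>The precision \<open>k - psize N\<close> becomes \<open>k\<close> once the identity is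
  multiplied by the Grothendieck function of \<open>N\<close>, which vanishes below
  \<open>psize N\<close>. Cutting by size instead of by first row changes only terms of that
  order.\<close>

lemma skew_cauchy:
  assumes x: "vanishes_below 1 x" and M: "is_partition M" and N: "is_partition N"
  shows "vanishes_below (k - psize N)
    ((\<Sum>L | (is_partition L \<and> psize L < k \<and> M \<le> L) \<and> horizontal_strip L N.
        strip_step x L N * dual_step \<alpha> \<beta> y (conjugate L) (conjugate M))
     - (1 + x * y) * (\<Sum>K | (is_partition K \<and> horizontal_strip M K) \<and> K \<le> N.
        strip_step x M K * dual_step \<alpha> \<beta> y (conjugate N) (conjugate K)))"
proof -
  define t where "t = strip_ratio \<beta> x"
  have t: "vanishes_below 1 t" unfolding t_def by (rule vanishes_below_strip_ratio[OF x])
  \<comment> \<open>The denominator of \<open>z\<close> is one minus a series of positive order,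
    hence a unit.\<close>
  have "(1 - (\<beta> - y) * t) dvd 1"
    by (intro mfps_one_minus_unit vanishes_below_mult_left t)
  moreover have "1 - (\<beta> - y) * t = 1 - \<beta> * t + t * y" by (simp add: algebra_simps)
  ultimately have "(1 - \<beta> * t + t * y) * inverse (1 - \<beta> * t + t * y) = 1"
    by (simp add: mfps_right_inverse)
  then interpret cauchy_parameters \<alpha> \<beta> x y t "y * inverse (1 - \<beta> * t + t * y)"
    using strip_ratio_eq[OF x] by unfold_locales (simp_all add: t_def mult.assoc mult.commute[of "inverse _"])
  have step: "grothendieck_step t s = strip_step x" unfolding s_def unfolding t_def by (rule refl)
  \<comment> \<open>Large enough to admit every \<open>L\<close> of size below \<open>k\<close>, to
    dominate both first rows, and to push the truncation error beyond degree
    \<open>k\<close>.\<close>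
  define T where "T = k + M 0 + N 0"
  let ?f = "\<lambda>L. grothendieck_step t s L N * dual_step \<alpha> \<beta> y (conjugate L) (conjugate M)"
  let ?A = "{L. (is_partition L \<and> psize L < k \<and> M \<le> L) \<and> horizontal_strip L N}"
  let ?B = "{L. is_partition L \<and> horizontal_strip L N \<and> M \<le> L \<and> L 0 \<le> T}"
  let ?S = "\<Sum>K | is_partition K \<and> horizontal_strip M K \<and> K \<le> N.
       grothendieck_step t s M K * dual_step \<alpha> \<beta> y (conjugate N) (conjugate K)"
  have "finite ?B"
  proof (rule finite_subset)
    \<comment> \<open>A partition containing all of \<open>?B\<close>: the strip condition bounds
      row \<open>Suc j\<close> by \<open>N j\<close>.\<close>
    define P where "P = (\<lambda>i. case i of 0 \<Rightarrow> T | Suc j \<Rightarrow> N j)"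
    obtain n where n: "\<And>i. i \<ge> n \<Longrightarrow> N i = 0" using is_partition_eventually_0[OF N] by blast
    have "is_partition P"
    proof (rule is_partitionI)
      show "P (Suc i) \<le> P i" for i
        using is_partition_antimono[OF N, of "i - 1" i]
        by (auto simp: P_def T_def split: nat.split)
      show "P i = 0" if "i \<ge> Suc n" for i using that n by (auto simp: P_def split: nat.split)
    qed
    then show "finite {L. is_partition L \<and> L \<le> P}" by (rule finite_subpartitions)
    show "?B \<subseteq> {L. is_partition L \<and> L \<le> P}"
      by (auto simp: P_def le_fun_def horizontal_strip_def split: nat.split)
  qed
  moreover have "?A \<subseteq> ?B"
  proof clarify
    fix L assume L: "is_partition L" "psize L < k"
    have "L 0 \<le> psize L"
    proof (cases "L 0 = 0")
      case False
      then show ?thesis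
        using L(1) unfolding psize_def is_partition_def by (intro member_le_sum) auto
    qed simp
    then show "L 0 \<le> T" using L(2) by (simp add: T_def)
  qed
  ultimately have split: "sum ?f ?A - (1 + x * y) * ?S = (sum ?f ?B - (1 + x * y) * ?S) + - sum ?f (?B - ?A)"
    by (simp add: sum.subset_diff[of ?A ?B])
  have "vanishes_below (k - psize N) (sum ?f ?B - (1 + x * y) * ?S)"
  proof (rule vanishes_below_dvd)
    show "t ^ (T + 1 - N 0) dvd sum ?f ?B - (1 + x * y) * ?S"
      by (rule skew_cauchy_truncated[OF M N]) (simp_all add: T_def)
    show "vanishes_below (k - psize N) (t ^ (T + 1 - N 0))"
      by (rule vanishes_below_mono[OF vanishes_below_power[OF t]]) (simp add: T_def)
  qed
  moreover have "vanishes_below (k - psize N) (sum ?f (?B - ?A))"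
  proof (rule vanishes_below_sum)
    fix L assume "L \<in> ?B - ?A"
    then have "k - psize N \<le> psize L - psize N" by auto
    then have "vanishes_below (k - psize N) (grothendieck_step t s L N)"
      using vanishes_below_strip_step[OF x, of L N] unfolding step
      by (rule vanishes_below_mono[rotated])
    then show "vanishes_below (k - psize N) (?f L)" by (rule vanishes_below_mult_right)
  qed
  ultimately have "vanishes_below (k - psize N) (sum ?f ?A - (1 + x * y) * ?S)"
    unfolding split by (intro vanishes_below_add vanishes_below_uminus)
  then show ?thesis by (simp only: step conj_assoc)
qed

text \<open>Induction on the number of \<open>x\<close> variables: split off the last strip from
  \<open>L\<close> to \<open>N\<close>, exchange it by the skew identity, and apply the hypothesis
  to each remaining \<open>K\<close>.\<close>

lemma canonical_G_pieri:
  assumes x: "\<And>i. vanishes_below 1 (x i)" and "is_partition M"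
  shows "vanishes_below k
    ((\<Sum>L | is_partition L \<and> psize L < k \<and> M \<le> L.
        canonical_G (- \<beta>) (- \<alpha>) x m L * dual_step \<alpha> \<beta> y (conjugate L) (conjugate M))
     - (\<Prod>i=1..m. 1 + x i * y) * canonical_G (- \<beta>) (- \<alpha>) x m M)"
  using assms(2)
proof (induction m arbitrary: M)
  case 0
  show ?case
  proof (cases "k = 0 \<or> M \<noteq> empty_partition")
    case True
    then show ?thesis
    proof
      assume M: "M \<noteq> empty_partition"
      then have "\<not> M \<le> empty_partition" by (auto simp: le_fun_def empty_partition_def fun_eq_iff)
      then have "(\<Sum>L | is_partition L \<and> psize L < k \<and> M \<le> L.
          canonical_G (- \<beta>) (- \<alpha>) x 0 L * dual_step \<alpha> \<beta> y (conjugate L) (conjugate M)) = 0"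
        by (intro sum.neutral) auto
      then show ?thesis using M by simp
    qed simp
  next
    case False
    let ?A = "{L. is_partition L \<and> psize L < k \<and> M \<le> L}"
    have "dual_step \<alpha> \<beta> y empty_partition empty_partition = 1"
      by (simp add: dual_step_def skew_rows_def skew_cols_def skew_components_def skew_cells_def
          empty_partition_def)
    moreover have "(\<Sum>L\<in>?A. canonical_G (- \<beta>) (- \<alpha>) x 0 L * dual_step \<alpha> \<beta> y (conjugate L) (conjugate M))
      = (\<Sum>L\<in>{empty_partition}. canonical_G (- \<beta>) (- \<alpha>) x 0 L * dual_step \<alpha> \<beta> y (conjugate L) (conjugate M))"
      using False
      by (intro sum.mono_neutral_right finite_subset[OF _ finite_partitions_psize_less[of k]]) auto
    ultimately show ?thesis using False by simp
  qed
next
  case (Suc m)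
  let ?G = "canonical_G (- \<beta>) (- \<alpha>) x" and ?X = "x (Suc m)"
  let ?d = "\<lambda>L M. dual_step \<alpha> \<beta> y (conjugate L) (conjugate M)"
  let ?A = "{L. is_partition L \<and> psize L < k \<and> M \<le> L}"
  let ?Q = "{N. is_partition N \<and> psize N < k}"
  let ?H = "{K. is_partition K \<and> horizontal_strip M K}"
  let ?P = "\<Prod>i=1..m. 1 + x i * y"
  let ?U = "\<lambda>N. \<Sum>L | L \<in> ?A \<and> horizontal_strip L N. strip_step ?X L N * ?d L M"
  let ?V = "\<lambda>N. \<Sum>K | K \<in> ?H \<and> K \<le> N. strip_step ?X M K * ?d N K"
  have finA: "finite ?A" by (rule finite_subset[OF _ finite_partitions_psize_less[of k]]) auto
  have finQ: "finite ?Q" by (rule finite_partitions_psize_less)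
  have finH: "finite ?H" by (rule finite_horizontal_strips[OF Suc.prems])
  have "(\<Sum>L\<in>?A. ?G (Suc m) L * ?d L M)
      = (\<Sum>L\<in>?A. \<Sum>N | N \<in> ?Q \<and> horizontal_strip L N. ?G m N * (strip_step ?X L N * ?d L M))"
  proof (rule sum.cong[OF refl])
    fix L assume "L \<in> ?A"
    \<comment> \<open>Every \<open>N\<close> inside \<open>L\<close> also has size below
      \<open>k\<close>, so both sums have fixed finite ranges and can be swapped.\<close>
    then have "{N. is_partition N \<and> horizontal_strip L N} = {N \<in> ?Q. horizontal_strip L N}"
      using le_less_trans[OF psize_mono[OF _ horizontal_strip_le]] by blast
    then show "?G (Suc m) L * ?d L M
        = (\<Sum>N | N \<in> ?Q \<and> horizontal_strip L N. ?G m N * (strip_step ?X L N * ?d L M))"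
      unfolding canonical_G_Suc_eq[OF x] by (simp only: sum_distrib_right mult.assoc)
  qed
  also have "\<dots> = (\<Sum>N\<in>?Q. \<Sum>L | L \<in> ?A \<and> horizontal_strip L N. ?G m N * (strip_step ?X L N * ?d L M))"
    by (rule sum.swap_restrict[OF finA finQ])
  also have "\<dots> = (\<Sum>N\<in>?Q. ?G m N * ?U N)"
    by (simp only: sum_distrib_left)
  finally have lhs: "(\<Sum>L\<in>?A. ?G (Suc m) L * ?d L M) = (\<Sum>N\<in>?Q. ?G m N * ?U N)" .
  \<comment> \<open>The intermediate expression given by the skew identity, regrouped by
    \<open>K\<close> for the induction hypothesis.\<close>
  have "(\<Sum>N\<in>?Q. ?G m N * ((1 + ?X * y) * ?V N))
      = (1 + ?X * y) * (\<Sum>N\<in>?Q. \<Sum>K | K \<in> ?H \<and> K \<le> N. strip_step ?X M K * (?G m N * ?d N K))"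
    by (simp only: sum_distrib_left ac_simps)
  also have "(\<Sum>N\<in>?Q. \<Sum>K | K \<in> ?H \<and> K \<le> N. strip_step ?X M K * (?G m N * ?d N K))
      = (\<Sum>K\<in>?H. \<Sum>N | N \<in> ?Q \<and> K \<le> N. strip_step ?X M K * (?G m N * ?d N K))"
    by (rule sum.swap_restrict[OF finQ finH])
  also have "\<dots> = (\<Sum>K\<in>?H. strip_step ?X M K
      * (\<Sum>N | is_partition N \<and> psize N < k \<and> K \<le> N. ?G m N * ?d N K))"
    by (simp add: sum_distrib_left conj_assoc)
  finally have mid: "(\<Sum>N\<in>?Q. ?G m N * ((1 + ?X * y) * ?V N)) = (1 + ?X * y) * \<dots>" .
  have rhs: "(\<Prod>i=1..Suc m. 1 + x i * y) * ?G (Suc m) M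
      = (1 + ?X * y) * (\<Sum>K\<in>?H. strip_step ?X M K * (?P * ?G m K))"
    unfolding canonical_G_Suc_eq[OF x] by (simp add: sum_distrib_left ac_simps)
  show ?case
  proof (rule vanishes_below_trans)
    show "vanishes_below k ((\<Sum>L\<in>?A. ?G (Suc m) L * ?d L M)
        - (\<Sum>N\<in>?Q. ?G m N * ((1 + ?X * y) * ?V N)))"
      unfolding lhs sum_subtractf[symmetric] right_diff_distrib[symmetric]
    proof (rule vanishes_below_sum)
      fix N assume N: "N \<in> ?Q"
      have "vanishes_below (k - psize N) (?U N - (1 + ?X * y) * ?V N)"
        using skew_cauchy[OF x Suc.prems, of N k "Suc m" y] N by simp
      with vanishes_below_canonical_G[OF x] N
      have "vanishes_below (psize N + (k - psize N)) (?G m N * (?U N - (1 + ?X * y) * ?V N))"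
        by (intro vanishes_below_mult) auto
      then show "vanishes_below k (?G m N * (?U N - (1 + ?X * y) * ?V N))"
        using N by simp
    qed
    show "vanishes_below k ((\<Sum>N\<in>?Q. ?G m N * ((1 + ?X * y) * ?V N))
        - (\<Prod>i=1..Suc m. 1 + x i * y) * ?G (Suc m) M)"
      unfolding mid rhs sum_subtractf[symmetric] right_diff_distrib[symmetric]
      using Suc.IH by (intro vanishes_below_mult_left vanishes_below_sum) auto
  qed
qed

text \<open>Induction on the number of \<open>y\<close> variables: splitting off the last one leaves
  the inner sum of \<open>canonical_G_pieri\<close>, which releases the factors containing that
  variable.\<close>

lemma dual_cauchy_truncated:
  assumes x: "\<And>i. vanishes_below 1 (x i)"
  shows "vanishes_below k
    ((\<Sum>L | is_partition L \<and> psize L < k.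
        canonical_G (- \<beta>) (- \<alpha>) x m L * dual_g \<alpha> \<beta> y n (conjugate L))
     - (\<Prod>i=1..m. \<Prod>j=1..n. 1 + x i * y j))"
proof (induction n)
  case 0
  show ?case
  proof (cases "k = 0")
    case False
    have empty: "conjugate L = empty_partition \<longleftrightarrow> L = empty_partition" if "is_partition L" for L
      using conjugate_conjugate[OF that] by auto
    have "(\<Sum>L | is_partition L \<and> psize L < k.
        canonical_G (- \<beta>) (- \<alpha>) x m L * dual_g \<alpha> \<beta> y 0 (conjugate L))
      = (\<Sum>L\<in>{empty_partition}. canonical_G (- \<beta>) (- \<alpha>) x m L * dual_g \<alpha> \<beta> y 0 (conjugate L))"
      using False by (intro sum.mono_neutral_right finite_partitions_psize_less) (auto simp: empty)
    then show ?thesis by (simp add: canonical_G_empty[OF x])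
  qed simp
next
  case (Suc n)
  let ?G = "canonical_G (- \<beta>) (- \<alpha>) x m" and ?g = "\<lambda>n M. dual_g \<alpha> \<beta> y n (conjugate M)"
  let ?d = "\<lambda>L M. dual_step \<alpha> \<beta> (y (Suc n)) (conjugate L) (conjugate M)"
  let ?Q = "{N. is_partition N \<and> psize N < k}"
  let ?P = "\<Prod>i=1..m. 1 + x i * y (Suc n)"
  have finQ: "finite ?Q" by (rule finite_partitions_psize_less)
  have "(\<Sum>L\<in>?Q. ?G L * ?g (Suc n) L) = (\<Sum>L\<in>?Q. \<Sum>M | M \<in> ?Q \<and> M \<le> L. ?g n M * (?G L * ?d L M))"
  proof (rule sum.cong[OF refl])
    fix L assume L: "L \<in> ?Q"
    then have "{M. is_partition M \<and> M \<le> L} = {M \<in> ?Q. M \<le> L}"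
      by (auto intro: le_less_trans psize_mono)
    then show "?G L * ?g (Suc n) L = (\<Sum>M | M \<in> ?Q \<and> M \<le> L. ?g n M * (?G L * ?d L M))"
      using L by (simp only: dual_g_Suc_conjugate mem_Collect_eq sum_distrib_left ac_simps)
  qed
  also have "\<dots> = (\<Sum>M\<in>?Q. \<Sum>L | L \<in> ?Q \<and> M \<le> L. ?g n M * (?G L * ?d L M))"
    by (rule sum.swap_restrict[OF finQ finQ])
  also have "\<dots> = (\<Sum>M\<in>?Q. ?g n M * (\<Sum>L | is_partition L \<and> psize L < k \<and> M \<le> L. ?G L * ?d L M))"
    by (simp add: sum_distrib_left conj_assoc)
  finally have lhs: "(\<Sum>L\<in>?Q. ?G L * ?g (Suc n) L) = \<dots>" .
  have mid: "(\<Sum>M\<in>?Q. ?g n M * (?P * ?G M)) = ?P * (\<Sum>M\<in>?Q. ?G M * ?g n M)"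
    by (simp add: sum_distrib_left ac_simps)
  have rhs: "(\<Prod>i=1..m. \<Prod>j=1..Suc n. 1 + x i * y j) = ?P * (\<Prod>i=1..m. \<Prod>j=1..n. 1 + x i * y j)"
    by (simp add: prod.distrib mult.commute)
  show ?case
  proof (rule vanishes_below_trans)
    show "vanishes_below k ((\<Sum>L\<in>?Q. ?G L * ?g (Suc n) L) - (\<Sum>M\<in>?Q. ?g n M * (?P * ?G M)))"
      unfolding lhs sum_subtractf[symmetric] right_diff_distrib[symmetric]
      using canonical_G_pieri[OF x] by (intro vanishes_below_mult_left vanishes_below_sum) auto
    show "vanishes_below k ((\<Sum>M\<in>?Q. ?g n M * (?P * ?G M))
        - (\<Prod>i=1..m. \<Prod>j=1..Suc n. 1 + x i * y j))"
      unfolding mid rhs right_diff_distrib[symmetric]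
      by (rule vanishes_below_mult_left[OF Suc])
  qed
qed

text \<open>Conjugation preserves size, so it matches the truncated sums; the terms left out have
  order at least their size.\<close>

lemma dual_cauchy:
  assumes x: "\<And>i. vanishes_below 1 (x i)"
  shows "((\<lambda>lam. canonical_G (- \<beta>) (- \<alpha>) x m (conjugate lam) * dual_g \<alpha> \<beta> y n lam)
    has_sum (\<Prod>i=1..m. \<Prod>j=1..n. 1 + x i * y j)) {lam. is_partition lam}"
proof (rule has_sum_mfpsI[where Q = "\<lambda>k. {lam. is_partition lam \<and> psize lam < k}"])
  fix k
  show "finite {lam. is_partition lam \<and> psize lam < k}" by (rule finite_partitions_psize_less)
  show "{lam. is_partition lam \<and> psize lam < k} \<subseteq> {lam. is_partition lam}" by auto
  have "(\<Sum>lam | is_partition lam \<and> psize lam < k.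
        canonical_G (- \<beta>) (- \<alpha>) x m (conjugate lam) * dual_g \<alpha> \<beta> y n lam)
      = (\<Sum>L | is_partition L \<and> psize L < k.
        canonical_G (- \<beta>) (- \<alpha>) x m L * dual_g \<alpha> \<beta> y n (conjugate L))"
    by (rule sum.reindex_bij_witness[where i = conjugate and j = conjugate])
       (auto simp: conjugate_conjugate is_partition_conjugate psize_conjugate)
  then show "vanishes_below k ((\<Sum>lam | is_partition lam \<and> psize lam < k.
        canonical_G (- \<beta>) (- \<alpha>) x m (conjugate lam) * dual_g \<alpha> \<beta> y n lam)
      - (\<Prod>i=1..m. \<Prod>j=1..n. 1 + x i * y j))"
    using dual_cauchy_truncated[OF x] by simp
next
  fix k lam assume lam: "lam \<in> {lam. is_partition lam} - {lam. is_partition lam \<and> psize lam < k}"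
  then have "vanishes_below (psize lam) (canonical_G (- \<beta>) (- \<alpha>) x m (conjugate lam))"
    using vanishes_below_canonical_G[OF x is_partition_conjugate] by (simp add: psize_conjugate)
  then show "vanishes_below k (canonical_G (- \<beta>) (- \<alpha>) x m (conjugate lam) * dual_g \<alpha> \<beta> y n lam)"
    using lam by (intro vanishes_below_mult_right) (auto elim: vanishes_below_mono)
qed

end

theorem theorem6p4:
  fixes \<alpha> \<beta> :: "'a :: comm_ring_1"
    and m n :: nat
    and x y :: "nat \<Rightarrow> (nat + nat, 'a) mfps"
  defines "x \<equiv> \<lambda>i. mVar (Inl i)" and "y \<equiv> \<lambda>j. mVar (Inr j)"
  shows "((\<lambda>lam. canonical_G (mConst (- \<beta>)) (mConst (- \<alpha>)) x m (conjugate lam)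
                 * dual_g (mConst \<alpha>) (mConst \<beta>) y n lam)
          has_sum (\<Prod>i=1..m. \<Prod>j=1..n. 1 + x i * y j)) {lam. is_partition lam}"
proof -
  have "mConst (- c) = - (mConst c :: (nat + nat, 'a) mfps)" for c
    by (rule mfps_eqI) (simp add: mConst.rep_eq uminus_mfps.rep_eq)
  moreover have "vanishes_below 1 (x i)" for i
    by (auto simp: x_def vanishes_below_def mVar.rep_eq)
  ultimately show ?thesis using dual_cauchy[of x] by simp
qed

end
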